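(* Let $n\ge 11$ be an integer and let $p\ge p_{JL}=\frac{n-2\sqrt{n-1}}{n-4-2\sqrt{n-1}}$. Let $u_0$ be a measurable function on $\mathbb{R}^n$ with $0\le u_0(x)\le v_\infty(x)$, and let $u$ be the nonnegative solution of $u_t=\Delta u+u^p$, $u(x,0)=u_0(x)$ (as specified in the context). Suppose that there exists a constant $b>0$ such that $$v_\infty(x)-b|x|^{-\sigma}\le u_0(x)\quad\text{for all }x\neq 0,$$ and that $$\lim_{|x|\to\infty}|x|^\sigma\big(v_\infty(x)-u_0(x)\big)=0.$$ Then $$\lim_{t\to\infty}\ \sup_{|x|\le\sqrt t}|x|^\sigma\big(v_\infty(x)-u(x,t)\big)=0$$ and $$\lim_{t\to\infty}\ t^{\frac{\sigma}{2}}\sup_{|x|\ge\sqrt t}\big(v_\infty(x)-u(x,t)\big)=0.$$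
   Context: The singular steady state is $$v_\infty(x)=L|x|^{-\frac{2}{p-1}},\qquad L=\Big(\tfrac{2}{p-1}\big(n-2-\tfrac{2}{p-1}\big)\Big)^{\frac1{p-1}},\quad x\in\mathbb{R}^n\setminus\{0\}.$$ The number $\sigma$ is $$\sigma=\sigma(n,p)=\frac{n-2}{2}-\sqrt{\frac{(n-2)^2}{4}-\frac{2p}{p-1}\Big(n-2-\frac{2}{p-1}\Big)}.$$ The solution $u$: for $0\le u_0\le v_\infty$ and $N>0$, let $u^N$ be the global-in-time nonnegative classical solution (bounded on $\mathbb{R}^n\times[0,T]$ for each $T$; initial datum understood in the usual mild/Duhamel sense) of $u_t=\Delta u+u^p$ on $\mathbb{R}^n\times(0,\infty)$ with initial datum $\min\{u_0(x),N\}$. Then $u(x,t)=\lim_{N\to\infty}u^N(x,t)$. Suprema and pointwise inequalities are over $x\ne 0$. *)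

theory Defs
  imports "HOL-Analysis.Analysis"
begin

definition p_JL :: "nat \<Rightarrow> real" where
  "p_JL n = (real n - 2 * sqrt (real n - 1)) / (real n - 4 - 2 * sqrt (real n - 1))"

definition sing_coeff :: "nat \<Rightarrow> real \<Rightarrow> real" where
  "sing_coeff n p = (2 / (p - 1) * (real n - 2 - 2 / (p - 1))) powr (1 / (p - 1))"

text \<open>The singular steady state. Its value at the origin is the junk value \<open>0\<close>
  (as \<open>0 powr a = 0\<close>), so it may only be used at \<open>x \<noteq> 0\<close>.\<close>

definition v_inf :: "real \<Rightarrow> real ^ 'n \<Rightarrow> real" where
  "v_inf p x = sing_coeff CARD('n) p * norm x powr (- 2 / (p - 1))"

definition sigma_exp :: "nat \<Rightarrow> real \<Rightarrow> real" where
  "sigma_exp n p = (real n - 2) / 2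
     - sqrt ((real n - 2)\<^sup>2 / 4 - 2 * p / (p - 1) * (real n - 2 - 2 / (p - 1)))"

definition heat_kernel :: "real \<Rightarrow> real ^ 'n \<Rightarrow> real" where
  "heat_kernel t z = (4 * pi * t) powr (- real CARD('n) / 2) * exp (- (norm z)\<^sup>2 / (4 * t))"

text \<open>\<open>w\<close> is a \<open>C\<^sup>2\<close>-in-space, \<open>C\<^sup>1\<close>-in-time solution of \<open>w\<^sub>t = \<Delta>w + w\<^sup>p\<close> at positive times.
  The witnesses \<open>wt\<close>, \<open>Dw\<close>, \<open>D2w\<close> are the time derivative, the spatial gradient and the spatial
  Hessian, so that \<open>trace (D2w x t)\<close> is the Laplacian.
  The power is \<open>powr\<close>, hence meaningful only for \<open>w \<ge> 0\<close>.\<close>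

definition classical_solution :: "real \<Rightarrow> (real ^ 'n \<Rightarrow> real \<Rightarrow> real) \<Rightarrow> bool" where
  "classical_solution p w \<longleftrightarrow>
     (\<exists>(wt :: real ^ 'n \<Rightarrow> real \<Rightarrow> real)
       (Dw :: real ^ 'n \<Rightarrow> real \<Rightarrow> real ^ 'n)
       (D2w :: real ^ 'n \<Rightarrow> real \<Rightarrow> real ^ 'n ^ 'n).
        continuous_on (UNIV \<times> {0<..}) (\<lambda>(x, t). w x t) \<and>
        continuous_on (UNIV \<times> {0<..}) (\<lambda>(x, t). wt x t) \<and>
        continuous_on (UNIV \<times> {0<..}) (\<lambda>(x, t). Dw x t) \<and>
        continuous_on (UNIV \<times> {0<..}) (\<lambda>(x, t). D2w x t) \<and>
        (\<forall>x. \<forall>t>0.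
           ((\<lambda>s. w x s) has_real_derivative wt x t) (at t) \<and>
           ((\<lambda>y. w y t) has_derivative (\<lambda>h. Dw x t \<bullet> h)) (at x) \<and>
           ((\<lambda>y. Dw y t) has_derivative (\<lambda>h. D2w x t *v h)) (at x) \<and>
           wt x t = trace (D2w x t) + w x t powr p))"

text \<open>Duhamel formula with initial datum \<open>w0\<close>. The integrals are taken with respect to
  \<open>lebesgue\<close> rather than \<open>lborel\<close>, because \<open>w0\<close> need only be Lebesgue measurable.\<close>

definition mild_solution ::
    "real \<Rightarrow> (real ^ 'n \<Rightarrow> real) \<Rightarrow> (real ^ 'n \<Rightarrow> real \<Rightarrow> real) \<Rightarrow> bool" where
  "mild_solution p w0 w \<longleftrightarrow>
     (\<forall>x. \<forall>t>0. w x t =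
        (\<integral>y. heat_kernel t (x - y) * w0 y \<partial>lebesgue) +
        (LINT s:{0<..<t}|lebesgue.
           (\<integral>y. heat_kernel (t - s) (x - y) * w y s powr p \<partial>lebesgue)))"

text \<open>The global nonnegative classical solution with bounded initial datum \<open>w0\<close>. All conditions
  concern positive times only: \<open>w0\<close> enters through the Duhamel formula, and the values of \<open>w\<close> at
  times \<open>t \<le> 0\<close> play no role.\<close>

definition global_solution ::
    "real \<Rightarrow> (real ^ 'n \<Rightarrow> real) \<Rightarrow> (real ^ 'n \<Rightarrow> real \<Rightarrow> real) \<Rightarrow> bool" where
  "global_solution p w0 w \<longleftrightarrow>
     (\<forall>x. \<forall>t>0. 0 \<le> w x t) \<and>
     (\<forall>T>0. \<exists>M. \<forall>x. \<forall>t\<in>{0<..T}. w x t \<le> M) \<and>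
     classical_solution p w \<and>
     mild_solution p w0 w"

text \<open>\<open>u\<close> is the limit of the solutions with truncated data. The origin is
  excluded, since the limit may be infinite there (for instance if \<open>u0 = v_inf p\<close>).\<close>

definition limit_solution ::
    "real \<Rightarrow> (real ^ 'n \<Rightarrow> real) \<Rightarrow> (real ^ 'n \<Rightarrow> real \<Rightarrow> real) \<Rightarrow> bool" where
  "limit_solution p u0 u \<longleftrightarrow>
     (\<exists>uN :: real \<Rightarrow> real ^ 'n \<Rightarrow> real \<Rightarrow> real.
        (\<forall>N>0. global_solution p (\<lambda>x. min (u0 x) N) (uN N)) \<and>
        (\<forall>x t. x \<noteq> 0 \<longrightarrow> t > 0 \<longrightarrow> ((\<lambda>N. uN N x t) \<longlongrightarrow> u x t) at_top))"

end

theory Submission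
  imports Defs "HOL-Probability.Distributions"
begin

text \<open>The difference \<open>v_inf - u\<close> is a subsolution of the linearization at \<open>v_inf\<close>, whose potential is
  \<open>s * (n - 2 - s) / \<bar>x\<bar>\<^sup>2\<close> with \<open>s = sigma_exp n p\<close>. This linear equation has the explicit positive solutions
  \<open>\<bar>x\<bar>\<^sup>-\<^sup>s * (e + A * (t + 1) powr (- d / 2) * exp (- \<bar>x\<bar>\<^sup>2 / (4 * (t + 1))))\<close> with \<open>d = n - 2 * s > 0\<close>.
  The hypotheses on \<open>u0\<close> allow one to put such a solution above \<open>v_inf - u0\<close> at time \<open>0\<close>, for any
  \<open>e > 0\<close> and a suitable \<open>A\<close>. Comparison keeps it above \<open>v_inf - u\<close>, and as \<open>t\<close> grows only the
  term \<open>e * \<bar>x\<bar>\<^sup>-\<^sup>s\<close> survives, uniformly in \<open>x\<close>.\<close>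

section \<open>The heat kernel\<close>

text \<open>The limit \<open>u\<close> carries no regularity, and both \<open>v_inf\<close> and the
  barrier blow up at the origin. So comparison is applied to each bounded truncated solution
  \<open>uN N\<close>, and only in an exterior domain |x| >= d where everything is bounded; near the
  origin the inequalities are settled by hand. Write m = 2 / (p - 1). For the upper bound,
  \<open>v_inf\<close> exceeds any bound of \<open>uN N\<close> near 0; for the lower bound, m < s
  lets e * |x|^-s beat \<open>v_inf\<close> there, whatever the size of e. The lower estimate has
  constants independent of N, so it survives N -> infinity. The number s is the smaller root of z *
  (n - 2 - z) = p * m * (n - 2 - m), the equation that makes |x|^-z a steady state of the
  linearization; p >= p_JL is what makes its roots real. That \<open>v_inf - u\<close> is a
  subsolution is the convexity of z^p. The data are merely measurable and enter through Duhamel's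
  formula, so initial values are compared via continuous bounded functions lying above or below the
  data. The shift t + 1 in the barrier keeps its Gaussian bounded and positive at time 0, so that a
  large A covers any given ball.\<close>

lemma heat_kernel_pos: "t > 0 \<Longrightarrow> heat_kernel t z > 0"
  by (simp add: heat_kernel_def)

lemma borel_measurable_heat_kernel [measurable]:
  fixes x :: "real ^ 'n"
  shows "(\<lambda>y. heat_kernel t (x - y)) \<in> borel_measurable borel"
  unfolding heat_kernel_def by measurable

text \<open>The Gaussian splits along the orthonormal basis into normal densities of variance 2 * t.
  Their mass is known, so the total mass of the kernel follows from the product structure of
  \<open>lborel\<close>.\<close>

lemma heat_kernel_eq_prod_normal_density:
  fixes x y :: "real ^ 'n"
  assumes "t > 0"
  shows "heat_kernel t (x - y) = (\<Prod>b\<in>Basis. normal_density (x \<bullet> b) (sqrt (2 * t)) (y \<bullet> b))"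
proof -
  have 1: "normal_density (x \<bullet> b) (sqrt (2 * t)) (y \<bullet> b)
      = (4 * pi * t) powr (- 1 / 2) * exp (- ((x - y) \<bullet> b)\<^sup>2 / (4 * t))" for b
    using assms
    by (simp add: normal_density_def powr_minus powr_half_sqrt power2_commute inner_diff_left
        field_simps)
  have 2: "(norm (x - y))\<^sup>2 = (\<Sum>b\<in>Basis. ((x - y) \<bullet> b)\<^sup>2)"
    unfolding power2_norm_eq_inner by (subst euclidean_inner) (simp add: power2_eq_square)
  have "(\<Prod>b\<in>Basis. normal_density (x \<bullet> b) (sqrt (2 * t)) (y \<bullet> b))
      = (\<Prod>b\<in>(Basis::(real^'n) set). (4 * pi * t) powr (- 1 / 2)) *
        (\<Prod>b\<in>Basis. exp (- ((x - y) \<bullet> b)\<^sup>2 / (4 * t)))"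
    unfolding 1 by (rule prod.distrib)
  also have "(\<Prod>b\<in>(Basis::(real^'n) set). (4 * pi * t) powr (- 1 / 2))
      = (4 * pi * t) powr (- real CARD('n) / 2)"
    using assms by (simp add: powr_power)
  also have "(\<Prod>b\<in>Basis. exp (- ((x - y) \<bullet> b)\<^sup>2 / (4 * t))) = exp (- (norm (x - y))\<^sup>2 / (4 * t))"
    by (simp add: exp_sum [symmetric] 2 sum_divide_distrib sum_negf)
  finally show ?thesis by (simp add: heat_kernel_def)
qed

lemma has_integral_heat_kernel:
  fixes x :: "real ^ 'n"
  assumes "t > 0"
  shows "has_bochner_integral lebesgue (\<lambda>y. heat_kernel t (x - y)) 1"
proof -
  let ?f = "\<lambda>b. normal_density (x \<bullet> b) (sqrt (2 * t))"
  have f1: "(\<integral>\<^sup>+y. ennreal (?f b y) \<partial>lborel) = 1" for b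
    using assms by (subst nn_integral_eq_integral) auto
  have "(\<integral>\<^sup>+y. ennreal (heat_kernel t (x - y)) \<partial>lborel)
      = (\<integral>\<^sup>+y. (\<Prod>b\<in>Basis. ennreal (?f b (y \<bullet> b))) \<partial>lborel)"
    using assms by (simp add: heat_kernel_eq_prod_normal_density prod_ennreal)
  also have "\<dots> = (\<Prod>b\<in>(Basis::(real^'n) set). \<integral>\<^sup>+y. ennreal (?f b y) \<partial>lborel)"
    by (rule nn_integral_lborel_prod) auto
  also have "\<dots> = 1" by (simp add: f1)
  finally have "(\<integral>\<^sup>+y. ennreal (heat_kernel t (x - y)) \<partial>lborel) = ennreal 1" by simp
  then have "has_bochner_integral lborel (\<lambda>y. heat_kernel t (x - y)) 1"
    using assms by (intro has_bochner_integral_nn_integral) (auto simp: less_imp_le heat_kernel_pos)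
  then show ?thesis
    by (simp add: has_bochner_integral_iff integrable_completion integral_completion)
qed

lemma integrable_heat_kernel: "t > 0 \<Longrightarrow> integrable lebesgue (\<lambda>y. heat_kernel t (x - y))"
  and integral_heat_kernel: "t > 0 \<Longrightarrow> (\<integral>y. heat_kernel t (x - y) \<partial>lebesgue) = 1"
  using has_integral_heat_kernel[of t x] by (auto simp: has_bochner_integral_iff)

lemma integrable_heat_kernel_mult:
  fixes f :: "real ^ 'n \<Rightarrow> real"
  assumes "t > 0" "f \<in> borel_measurable lebesgue" "AE y in lebesgue. \<bar>f y\<bar> \<le> B"
  shows "integrable lebesgue (\<lambda>y. heat_kernel t (x - y) * f y)"
proof (rule Bochner_Integration.integrable_bound)
  show "integrable lebesgue (\<lambda>y. heat_kernel t (x - y) * B)"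
    using integrable_heat_kernel[OF assms(1), of x] by simp
  have "(\<lambda>y. heat_kernel t (x - y)) \<in> borel_measurable lebesgue"
    by (rule measurable_completion) simp
  then show "(\<lambda>y. heat_kernel t (x - y) * f y) \<in> borel_measurable lebesgue"
    using assms(2) by simp
  show "AE y in lebesgue. norm (heat_kernel t (x - y) * f y) \<le> norm (heat_kernel t (x - y) * B)"
    using assms(3)
  proof eventually_elim
    case (elim y)
    then show ?case
      using heat_kernel_pos[OF assms(1), of "x - y"] by (auto simp: abs_mult intro!: mult_left_mono)
  qed
qed

lemma borel_measurable_continuous_lebesgue:
  fixes f :: "real ^ 'n \<Rightarrow> real"
  assumes "continuous_on UNIV f"
  shows "f \<in> borel_measurable lebesgue"
  using borel_measurable_continuous_onI[OF assms] by (intro measurable_completion) simp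

text \<open>Away from the origin the kernel is dominated by a small multiple of the kernel at time
  \<open>2 * t\<close>, so no moment of the Gaussian has to be computed.\<close>

lemma heat_kernel_tail:
  fixes z :: "real ^ 'n"
  assumes "t > 0" "d > 0" "norm z \<ge> d"
  shows "heat_kernel t z \<le> 2 powr (real CARD('n) / 2) * (8 * t / d\<^sup>2) * heat_kernel (2 * t) z"
proof -
  let ?n = "real CARD('n)"
  have dz: "d\<^sup>2 \<le> (norm z)\<^sup>2" using assms by (simp add: power_mono)
  \<comment> \<open>One half of the exponent is kept as the Gaussian of time \<open>2 * t\<close>;
    the other half is made small through exp u >= u.\<close>
  have "exp (- (norm z)\<^sup>2 / (4 * t)) = exp (- (norm z)\<^sup>2 / (8 * t)) * exp (- (norm z)\<^sup>2 / (8 * t))"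
    by (simp add: exp_add [symmetric] field_simps)
  moreover have "exp (- (norm z)\<^sup>2 / (8 * t)) \<le> 8 * t / d\<^sup>2"
  proof -
    have "d\<^sup>2 / (8 * t) \<le> (norm z)\<^sup>2 / (8 * t)" using dz assms by (simp add: divide_right_mono)
    also have "\<dots> \<le> exp ((norm z)\<^sup>2 / (8 * t))"
      using exp_ge_add_one_self[of "(norm z)\<^sup>2 / (8 * t)"] by linarith
    finally have "inverse (exp ((norm z)\<^sup>2 / (8 * t))) \<le> inverse (d\<^sup>2 / (8 * t))"
      using assms by (intro le_imp_inverse_le) auto
    then show ?thesis by (simp add: exp_minus)
  qed
  ultimately have 1: "exp (- (norm z)\<^sup>2 / (4 * t)) \<le> 8 * t / d\<^sup>2 * exp (- (norm z)\<^sup>2 / (8 * t))"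
    by (metis exp_ge_zero mult_right_mono)
  have 2: "(4 * pi * t) powr (- ?n / 2) = 2 powr (?n / 2) * (4 * pi * (2 * t)) powr (- ?n / 2)"
  proof -
    have "(4 * pi * (2 * t)) powr (- ?n / 2) = (2 * (4 * pi * t)) powr (- ?n / 2)"
      by (simp add: mult_ac)
    also have "\<dots> = 2 powr (- ?n / 2) * (4 * pi * t) powr (- ?n / 2)"
      using assms by (intro powr_mult)
    finally show ?thesis by (simp add: powr_minus)
  qed
  have "heat_kernel t z = (4 * pi * t) powr (- ?n / 2) * exp (- (norm z)\<^sup>2 / (4 * t))"
    by (simp add: heat_kernel_def)
  also have "\<dots> \<le> (4 * pi * t) powr (- ?n / 2) * (8 * t / d\<^sup>2 * exp (- (norm z)\<^sup>2 / (8 * t)))"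
    using 1 by (intro mult_left_mono) auto
  also have "\<dots> = 2 powr (?n / 2) * (8 * t / d\<^sup>2) * heat_kernel (2 * t) z"
    unfolding 2 heat_kernel_def by simp
  finally show ?thesis .
qed

text \<open>Points y close to x are handled by uniform continuity on a compact ball, distant ones by
  \<open>heat_kernel_tail\<close>. The bound is uniform for |x| <= R because the minimum principle
  below needs control of small times on whole balls.\<close>

lemma heat_kernel_approximate_identity:
  fixes f :: "real ^ 'n \<Rightarrow> real"
  assumes cont: "continuous_on UNIV f" and bd: "\<And>y. \<bar>f y\<bar> \<le> B" and e: "e > 0"
  shows "\<exists>t0>0. \<forall>x t. norm x \<le> R \<longrightarrow> 0 < t \<longrightarrow> t \<le> t0 \<longrightarrow>
           \<bar>(\<integral>y. heat_kernel t (x - y) * f y \<partial>lebesgue) - f x\<bar> \<le> e"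
proof -
  have "uniformly_continuous_on (cball 0 (R + 1)) f"
    using cont by (intro compact_uniformly_continuous) (auto intro: continuous_on_subset)
  then obtain d0 where d0: "d0 > 0" and
    u0: "\<And>x y. x \<in> cball 0 (R+1) \<Longrightarrow> y \<in> cball 0 (R+1) \<Longrightarrow> dist y x < d0 \<Longrightarrow> dist (f y) (f x) < e/2"
    unfolding uniformly_continuous_on_def using e by (meson half_gt_zero)
  \<comment> \<open>The cap 1 keeps every y with \<open>dist y x < d\<close> inside the ball of
    radius R + 1.\<close>
  define d where "d = min d0 1"
  have d: "d > 0" "d \<le> d0" "d \<le> 1" using d0 by (auto simp: d_def)
  define P where "P = 2 powr (real CARD('n) / 2)"
  have P: "P > 0" by (simp add: P_def)
  have B: "B \<ge> 0" using bd[of 0] by linarith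
  \<comment> \<open>Solves 2 * (B + 1) * P * 8 * t0 / d^2 = e / 2, so the far part contributes at
    most e / 2; B + 1 instead of B avoids dividing by zero.\<close>
  define t0 where "t0 = e * d\<^sup>2 / (32 * (B + 1) * P)"
  have t0: "t0 > 0" using e d B P by (simp add: t0_def)
  have "\<bar>(\<integral>y. heat_kernel t (x - y) * f y \<partial>lebesgue) - f x\<bar> \<le> e"
    if x: "norm x \<le> R" and t: "0 < t" "t \<le> t0" for x t
  proof -
    define Q where "Q = 2 * B * (P * (8 * t / d\<^sup>2))"
    have Q: "Q \<le> e / 2"
    proof -
      have "Q \<le> 2 * (B + 1) * (P * (8 * t0 / d\<^sup>2))"
        unfolding Q_def using t B P d by (intro mult_mono divide_right_mono) auto
      also have "\<dots> = e / 2"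
      proof -
        have "B + 1 \<noteq> 0" using B by simp
        then show ?thesis using P d unfolding t0_def
          by (simp del: distrib_left_numeral distrib_right_numeral add: divide_simps)
      qed
      finally show ?thesis .
    qed
    \<comment> \<open>Adding the near and far bounds gives one majorant valid for all y, with
      integral e / 2 + Q; the domain of integration is never split.\<close>
    have pt: "\<bar>heat_kernel t (x - y) * (f y - f x)\<bar>
        \<le> e/2 * heat_kernel t (x - y) + Q * heat_kernel (2 * t) (x - y)" for y
    proof (cases "dist y x < d")
      case True
      then have "norm y \<le> R + 1" using x d norm_triangle_ineq[of x "y - x"]
        by (simp add: dist_norm)
      then have "\<bar>f y - f x\<bar> \<le> e/2" using u0[of x y] x True d by (auto simp: dist_norm)
      then have "\<bar>heat_kernel t (x - y) * (f y - f x)\<bar> \<le> heat_kernel t (x - y) * (e/2)"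
        unfolding abs_mult using heat_kernel_pos[OF t(1), of "x - y"] by (intro mult_mono) auto
      moreover have "0 \<le> Q * heat_kernel (2 * t) (x - y)"
        using B P d t heat_kernel_pos[of "2*t" "x - y"] by (auto simp: Q_def)
      ultimately show ?thesis by (simp add: mult.commute)
    next
      case False
      then have "norm (x - y) \<ge> d" by (simp add: dist_norm norm_minus_commute)
      from heat_kernel_tail[OF t(1) d(1) this]
      have h: "heat_kernel t (x - y) \<le> P * (8 * t / d\<^sup>2) * heat_kernel (2 * t) (x - y)"
        by (simp add: P_def)
      have "\<bar>f y - f x\<bar> \<le> 2 * B" using bd[of x] bd[of y] by linarith
      then have "\<bar>heat_kernel t (x - y) * (f y - f x)\<bar>
          \<le> (P * (8 * t / d\<^sup>2) * heat_kernel (2 * t) (x - y)) * (2 * B)"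
        unfolding abs_mult using heat_kernel_pos[OF t(1), of "x - y"] h by (intro mult_mono) auto
      then have "\<bar>heat_kernel t (x - y) * (f y - f x)\<bar> \<le> Q * heat_kernel (2 * t) (x - y)"
        by (simp add: Q_def mult_ac)
      moreover have "0 \<le> e/2 * heat_kernel t (x - y)"
        using heat_kernel_pos[OF t(1), of "x - y"] e by simp
      ultimately show ?thesis by linarith
    qed
    have if1: "integrable lebesgue (\<lambda>y. heat_kernel t (x - y) * f y)"
      by (rule integrable_heat_kernel_mult[OF t(1) borel_measurable_continuous_lebesgue[OF cont]])
         (use bd in auto)
    have if2: "integrable lebesgue (\<lambda>y. heat_kernel t (x - y) * f x)"
      using integrable_heat_kernel[OF t(1), of x] by simp
    have if3: "integrable lebesgue (\<lambda>y. e/2 * heat_kernel t (x - y) + Q * heat_kernel (2 * t) (x - y))"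
      using integrable_heat_kernel[OF t(1), of x] integrable_heat_kernel[of "2 * t" x] t by simp
    have "(\<integral>y. heat_kernel t (x - y) * f y \<partial>lebesgue) - f x
        = (\<integral>y. heat_kernel t (x - y) * f y - heat_kernel t (x - y) * f x \<partial>lebesgue)"
      using if1 if2 integral_heat_kernel[OF t(1), of x] by simp
    also have "\<dots> = (\<integral>y. heat_kernel t (x - y) * (f y - f x) \<partial>lebesgue)"
      by (simp add: right_diff_distrib)
    also have "\<bar>\<dots>\<bar> \<le> (\<integral>y. e/2 * heat_kernel t (x - y) + Q * heat_kernel (2 * t) (x - y) \<partial>lebesgue)"
      using if1 if2 if3 pt by (intro integral_abs_bound_integral) (auto simp: right_diff_distrib)
    also have "\<dots> = e/2 + Q"
      using integrable_heat_kernel[OF t(1), of x] integrable_heat_kernel[of "2 * t" x] t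
        integral_heat_kernel[OF t(1), of x] integral_heat_kernel[of "2 * t" x] by simp
    finally show ?thesis using Q by linarith
  qed
  with t0 show ?thesis by blast
qed

section \<open>Pointwise Laplacians\<close>

definition has_laplacian :: "(real ^ 'n \<Rightarrow> real) \<Rightarrow> real \<Rightarrow> real ^ 'n \<Rightarrow> bool" where
  "has_laplacian f l x \<longleftrightarrow>
     (\<exists>g c. l = (\<Sum>i\<in>UNIV. c i) \<and>
        (\<forall>i. (\<forall>\<^sub>F s in nhds 0. ((\<lambda>s. f (x + s *\<^sub>R axis i 1)) has_real_derivative g i s) (at s)) \<and>
             (g i has_real_derivative c i) (at 0)))"

lemma has_laplacian_add:
  assumes "has_laplacian f l x" "has_laplacian g k x"
  shows "has_laplacian (\<lambda>x. f x + g x) (l + k) x"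
proof -
  obtain f' c where f: "l = (\<Sum>i\<in>UNIV. c i)"
    "\<And>i. \<forall>\<^sub>F s in nhds 0. ((\<lambda>s. f (x + s *\<^sub>R axis i 1)) has_real_derivative f' i s) (at s)"
    "\<And>i. (f' i has_real_derivative c i) (at 0)"
    using assms(1) unfolding has_laplacian_def by blast
  obtain g' d where g: "k = (\<Sum>i\<in>UNIV. d i)"
    "\<And>i. \<forall>\<^sub>F s in nhds 0. ((\<lambda>s. g (x + s *\<^sub>R axis i 1)) has_real_derivative g' i s) (at s)"
    "\<And>i. (g' i has_real_derivative d i) (at 0)"
    using assms(2) unfolding has_laplacian_def by blast
  show ?thesis
    unfolding has_laplacian_def
  proof (intro exI[of _ "\<lambda>i s. f' i s + g' i s"] exI[of _ "\<lambda>i. c i + d i"] conjI allI)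
    show "\<forall>\<^sub>F s in nhds 0. ((\<lambda>s. f (x + s *\<^sub>R axis i 1) + g (x + s *\<^sub>R axis i 1))
        has_real_derivative f' i s + g' i s) (at s)" for i
      using f(2)[of i] g(2)[of i] by eventually_elim (rule DERIV_add)
  qed (use f g in \<open>auto simp: sum.distrib intro!: DERIV_add\<close>)
qed

lemma has_laplacian_cmult:
  assumes "has_laplacian f l x"
  shows "has_laplacian (\<lambda>x. a * f x) (a * l) x"
proof -
  obtain f' c where f: "l = (\<Sum>i\<in>UNIV. c i)"
    "\<And>i. \<forall>\<^sub>F s in nhds 0. ((\<lambda>s. f (x + s *\<^sub>R axis i 1)) has_real_derivative f' i s) (at s)"
    "\<And>i. (f' i has_real_derivative c i) (at 0)"
    using assms(1) unfolding has_laplacian_def by blast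
  show ?thesis
    unfolding has_laplacian_def
  proof (intro exI[of _ "\<lambda>i s. a * f' i s"] exI[of _ "\<lambda>i. a * c i"] conjI allI)
    show "\<forall>\<^sub>F s in nhds 0. ((\<lambda>s. a * f (x + s *\<^sub>R axis i 1)) has_real_derivative a * f' i s) (at s)" for i
      using f(2)[of i] by eventually_elim (rule DERIV_cmult)
  qed (use f in \<open>auto simp: sum_distrib_left intro!: DERIV_cmult\<close>)
qed

lemma has_laplacian_diff:
  assumes "has_laplacian f l x" "has_laplacian g k x"
  shows "has_laplacian (\<lambda>x. f x - g x) (l - k) x"
  using has_laplacian_add[OF assms(1) has_laplacian_cmult[OF assms(2), of "-1"]] by simp

lemma has_laplacian_const: "has_laplacian (\<lambda>x. a) 0 x"
  unfolding has_laplacian_def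
  by (intro exI[of _ "\<lambda>i s. 0"] exI[of _ "\<lambda>i. 0"]) auto

text \<open>Links the gradient and Hessian witnesses of \<open>classical_solution\<close> to the
  coordinatewise notion.\<close>

lemma has_laplacian_of_has_derivative:
  fixes f :: "real ^ 'n \<Rightarrow> real"
  assumes "\<And>y. (f has_derivative (\<lambda>h. Df y \<bullet> h)) (at y)"
    and "(Df has_derivative (\<lambda>h. A *v h)) (at x)"
  shows "has_laplacian f (trace A) x"
  unfolding has_laplacian_def
proof (intro exI[of _ "\<lambda>i s. Df (x + s *\<^sub>R axis i 1) $ i"] exI[of _ "\<lambda>i. A $ i $ i"] conjI allI)
  fix i :: 'n
  have line: "((\<lambda>s. x + s *\<^sub>R axis i 1) has_derivative (\<lambda>h. h *\<^sub>R axis i 1)) (at s)" for s :: real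
    by (auto intro!: derivative_eq_intros)
  have "((\<lambda>s. f (x + s *\<^sub>R axis i 1)) has_real_derivative Df (x + s *\<^sub>R axis i 1) $ i) (at s)" for s
    using has_derivative_compose[OF line assms(1)]
    by (simp add: has_field_derivative_def inner_axis mult_commute_abs)
  then show "\<forall>\<^sub>F s in nhds 0.
      ((\<lambda>s. f (x + s *\<^sub>R axis i 1)) has_real_derivative Df (x + s *\<^sub>R axis i 1) $ i) (at s)"
    by simp
  have "((\<lambda>s. Df (x + s *\<^sub>R axis i 1)) has_derivative (\<lambda>h. A *v (h *\<^sub>R axis i 1))) (at 0)"
    by (rule has_derivative_compose[OF line]) (use assms(2) in simp)
  then have "((\<lambda>s. Df (x + s *\<^sub>R axis i 1) $ i) has_derivative (\<lambda>h. (A *v (h *\<^sub>R axis i 1)) $ i)) (at 0)"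
    by (rule bounded_linear.has_derivative[OF bounded_linear_vec_nth])
  moreover have "(A *v (h *\<^sub>R axis i 1)) $ i = A $ i $ i * h" for h
    by (simp add: matrix_vector_mult_scaleR matrix_vector_mul_component inner_axis)
  ultimately show "((\<lambda>s. Df (x + s *\<^sub>R axis i 1) $ i) has_real_derivative A $ i $ i) (at 0)"
    by (simp add: has_field_derivative_def)
qed (simp add: trace_def)

lemma norm_add_axis_power2:
  fixes x :: "real ^ 'n"
  shows "(norm (x + s *\<^sub>R axis i 1))\<^sup>2 = (norm x)\<^sup>2 + 2 * s * x $ i + s\<^sup>2"
  unfolding power2_norm_eq_inner
  by (simp add: inner_add_left inner_add_right inner_axis inner_axis'
      power2_eq_square algebra_simps)

text \<open>The variable q = |x|^2 is used in place of |x| because it is a polynomial of degree two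
  along each coordinate line, so the chain rule gives the second derivatives directly.\<close>

lemma has_laplacian_radial:
  fixes x :: "real ^ 'n"
  assumes "x \<noteq> 0"
    and F1: "\<And>q. q > 0 \<Longrightarrow> (F has_real_derivative F1 q) (at q)"
    and F2: "\<And>q. q > 0 \<Longrightarrow> (F1 has_real_derivative F2 q) (at q)"
  shows "has_laplacian (\<lambda>y. F ((norm y)\<^sup>2))
    (4 * (norm x)\<^sup>2 * F2 ((norm x)\<^sup>2) + 2 * real CARD('n) * F1 ((norm x)\<^sup>2)) x"
proof -
  let ?r = "\<lambda>i s. (norm (x + s *\<^sub>R axis i 1))\<^sup>2"
  note r = norm_add_axis_power2[of x]
  have dr: "((\<lambda>s. ?r i s) has_real_derivative 2 * x $ i + 2 * s) (at s)" for i s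
    unfolding r by (auto intro!: derivative_eq_intros)
  have ev: "\<forall>\<^sub>F s in nhds 0. ?r i s > 0" for i
  proof -
    have "((\<lambda>s. ?r i s) \<longlongrightarrow> ?r i 0) (nhds 0)"
      unfolding r by (intro tendsto_intros filterlim_ident)
    then show ?thesis using assms(1) by (intro order_tendstoD(1)) auto
  qed
  show ?thesis
    unfolding has_laplacian_def
  proof (intro exI[of _ "\<lambda>i s. F1 (?r i s) * (2 * x $ i + 2 * s)"]
      exI[of _ "\<lambda>i. F2 ((norm x)\<^sup>2) * (2 * x $ i)\<^sup>2 + F1 ((norm x)\<^sup>2) * 2"] conjI allI)
    have s: "(\<Sum>i\<in>UNIV. (x $ i)\<^sup>2) = (norm x)\<^sup>2"
      by (simp add: norm_vec_def L2_set_def sum_nonneg)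
    show "4 * (norm x)\<^sup>2 * F2 ((norm x)\<^sup>2) + 2 * real CARD('n) * F1 ((norm x)\<^sup>2)
      = (\<Sum>i\<in>UNIV. F2 ((norm x)\<^sup>2) * (2 * x $ i)\<^sup>2 + F1 ((norm x)\<^sup>2) * 2)"
      by (simp add: sum.distrib power_mult_distrib sum_distrib_left[symmetric] s)
  next
    fix i
    show "\<forall>\<^sub>F s in nhds 0. ((\<lambda>s. F (?r i s)) has_real_derivative F1 (?r i s) * (2 * x $ i + 2 * s)) (at s)"
      using ev[of i] by eventually_elim (rule DERIV_chain2[OF F1 dr])
    have pos: "?r i 0 > 0" using assms(1) by simp
    have "((\<lambda>s. F1 (?r i s)) has_real_derivative F2 (?r i 0) * (2 * x $ i + 2 * 0)) (at 0)"
      by (rule DERIV_chain2[OF F2[OF pos] dr])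
    then have "((\<lambda>s. F1 (?r i s) * (2 * x $ i + 2 * s)) has_real_derivative
       F2 (?r i 0) * (2 * x $ i + 2 * 0) * (2 * x $ i + 2 * 0) + 2 * F1 (?r i 0)) (at 0)"
      by (auto intro!: derivative_eq_intros)
    then show "((\<lambda>s. F1 (?r i s) * (2 * x $ i + 2 * s)) has_real_derivative
       F2 ((norm x)\<^sup>2) * (2 * x $ i)\<^sup>2 + F1 ((norm x)\<^sup>2) * 2) (at 0)"
      by (simp add: power2_eq_square mult_ac)
  qed
qed

text \<open>Computed directly, since the radial formula excludes the origin.\<close>

lemma has_laplacian_norm_power2:
  fixes x :: "real ^ 'n"
  shows "has_laplacian (\<lambda>y. (norm y)\<^sup>2) (2 * real CARD('n)) x"
  unfolding has_laplacian_def
proof (intro exI[of _ "\<lambda>i s. 2 * x $ i + 2 * s"] exI[of _ "\<lambda>i. 2"] conjI allI)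
  fix i :: 'n
  show "\<forall>\<^sub>F s in nhds 0. ((\<lambda>s. (norm (x + s *\<^sub>R axis i 1))\<^sup>2) has_real_derivative 2 * x $ i + 2 * s) (at s)"
    unfolding norm_add_axis_power2 by (auto intro!: derivative_eq_intros always_eventually)
qed (auto intro!: derivative_eq_intros)

section \<open>Second order conditions at a local minimum\<close>

text \<open>The second derivative is known at \<open>a\<close> alone, so Taylor's formula is
  replaced by the mean value theorem: c < 0 would make g negative just to the right of its zero
  \<open>a\<close>, and f would drop below f a.\<close>

lemma second_derivative_nonneg_at_local_min:
  fixes f :: "real \<Rightarrow> real"
  assumes f: "\<forall>\<^sub>F s in nhds a. (f has_real_derivative g s) (at s)"
    and g: "(g has_real_derivative c) (at a)"
    and min: "\<forall>\<^sub>F s in nhds a. f a \<le> f s"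
  shows "c \<ge> 0"
proof (rule ccontr)
  assume "\<not> c \<ge> 0"
  then have c: "c < 0" by simp
  have "\<forall>\<^sub>F s in nhds a. (f has_real_derivative g s) (at s) \<and> f a \<le> f s"
    using f min by (rule eventually_conj)
  then obtain d where d: "d > 0" and
    D: "\<And>s. \<bar>s - a\<bar> < d \<Longrightarrow> (f has_real_derivative g s) (at s)" and M: "\<And>s. \<bar>s - a\<bar> < d \<Longrightarrow> f a \<le> f s"
    unfolding eventually_nhds_metric by (auto simp: dist_real_def)
  have g0: "g a = 0"
    by (rule DERIV_local_min[OF D d]) (use d M in \<open>auto simp: abs_minus_commute\<close>)
  obtain d' where d': "d' > 0" and dec: "\<And>h. h > 0 \<Longrightarrow> h < d' \<Longrightarrow> g a > g (a + h)"
    using DERIV_neg_dec_right[OF g c] by blast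
  define h where "h = min d d' / 2"
  have h: "h > 0" "h < d" "h < d'" using d d' by (auto simp: h_def)
  obtain z where z: "a < z" "z < a + h" "f (a + h) - f a = (a + h - a) * g z"
  proof -
    have "a < a + h" using h by simp
    moreover have "(f has_real_derivative g s) (at s)" if "a \<le> s" "s \<le> a + h" for s
      using that h by (intro D) auto
    ultimately show thesis using MVT2[of a "a + h" f g] that by blast
  qed
  have "g z < 0" using dec[of "z - a"] z h g0 by simp
  then have "h * g z < 0" using h by (simp add: mult_pos_neg)
  then have "f (a + h) < f a" using z by simp
  moreover have "f a \<le> f (a + h)" using M[of "a + h"] h by simp
  ultimately show False by simp
qed

lemma laplacian_nonneg_at_local_min:
  fixes f :: "real ^ 'n \<Rightarrow> real"
  assumes "has_laplacian f l x" and min: "\<forall>\<^sub>F y in nhds x. f x \<le> f y"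
  shows "l \<ge> 0"
proof -
  obtain f' c where f: "l = (\<Sum>i\<in>UNIV. c i)"
    "\<And>i. \<forall>\<^sub>F s in nhds 0. ((\<lambda>s. f (x + s *\<^sub>R axis i 1)) has_real_derivative f' i s) (at s)"
    "\<And>i. (f' i has_real_derivative c i) (at 0)"
    using assms(1) unfolding has_laplacian_def by blast
  have "c i \<ge> 0" for i
  proof (rule second_derivative_nonneg_at_local_min[OF f(2) f(3)])
    have "((\<lambda>s. x + s *\<^sub>R axis i 1) \<longlongrightarrow> x + 0 *\<^sub>R axis i 1) (nhds (0::real))"
      by (intro tendsto_intros filterlim_ident)
    then have "filterlim (\<lambda>s. x + s *\<^sub>R axis i 1) (nhds x) (nhds (0::real))" by simp
    from eventually_compose_filterlim[OF min this]
    show "\<forall>\<^sub>F s in nhds 0. f (x + 0 *\<^sub>R axis i 1) \<le> f (x + s *\<^sub>R axis i 1)"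
      by simp
  qed
  then show ?thesis by (simp add: f(1) sum_nonneg)
qed

section \<open>Minimum principle in an exterior domain\<close>

text \<open>The factor exp (- C * t) absorbs the zero order term, and a small multiple of a strict
  supersolution growing like |x|^2 forces a negative minimum into a compact set, where the first and
  second order conditions contradict each other. The inequality \<open>super\<close> is demanded
  only where h < 0, which is where the nonlinear terms can be estimated.\<close>

lemma minimum_principle_exterior:
  fixes h :: "real ^ 'n \<Rightarrow> real \<Rightarrow> real"
  assumes C: "C \<ge> 0"
    and cont: "continuous_on ({x. norm x \<ge> d} \<times> {0<..T}) (\<lambda>(x, t). h x t)"
    and bdd: "\<And>x t. norm x \<ge> d \<Longrightarrow> 0 < t \<Longrightarrow> t \<le> T \<Longrightarrow> - B \<le> h x t"
    and lateral: "\<And>x t. norm x = d \<Longrightarrow> 0 < t \<Longrightarrow> t \<le> T \<Longrightarrow> 0 \<le> h x t"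
    and initial: "\<And>R e. e > 0 \<Longrightarrow> \<exists>t0>0. \<forall>x t. d \<le> norm x \<longrightarrow> norm x \<le> R \<longrightarrow> 0 < t \<longrightarrow> t \<le> t0 \<longrightarrow> - e \<le> h x t"
    and super: "\<And>x t. norm x > d \<Longrightarrow> 0 < t \<Longrightarrow> t \<le> T \<Longrightarrow> h x t < 0 \<Longrightarrow>
      \<exists>ht l. (h x has_real_derivative ht) (at t) \<and> has_laplacian (\<lambda>y. h y t) l x \<and> ht - l \<ge> C * h x t"
    and x1: "norm x1 \<ge> d" and t1: "0 < t1" "t1 \<le> T"
  shows "h x1 t1 \<ge> 0"
proof (rule ccontr)
  assume "\<not> h x1 t1 \<ge> 0"
  then have neg: "h x1 t1 < 0" by simp
  let ?n = "real CARD('n)"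
  \<comment> \<open>The time derivative 2 * n + 1 exceeds the Laplacian 2 * n by 1; this surplus
    gives strictness at the end.\<close>
  define w where "w x t = (norm x)\<^sup>2 + (2 * ?n + 1) * t + 1" for x :: "real ^ 'n" and t
  have w1: "w x t \<ge> (norm x)\<^sup>2 + 1" if "t > 0" for x t
    using that by (auto simp: w_def)
  \<comment> \<open>Chosen so that \<open>e * w\<close> cancels exactly half of the negative value
    at (x1, t1).\<close>
  define e where "e = - exp (- C * t1) * h x1 t1 / (2 * w x1 t1)"
  have wpos: "w x1 t1 > 0" using w1[OF t1(1), of x1] by (smt (verit) zero_le_power2)
  have "exp (- C * t1) * h x1 t1 < 0" using neg by (intro mult_pos_neg) auto
  then have e: "e > 0" using wpos unfolding e_def by (intro divide_pos_pos) linarith+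
  define G where "G x t = exp (- C * t) * h x t + e * w x t" for x t
  have G1: "G x1 t1 < 0"
  proof -
    have "e * w x1 t1 = - exp (- C * t1) * h x1 t1 / 2" using wpos by (simp add: e_def)
    moreover have "exp (- C * t1) * h x1 t1 < 0" using neg by (simp add: mult_pos_neg)
    ultimately show ?thesis unfolding G_def by linarith
  qed
  define B' where "B' = max B 0"
  \<comment> \<open>From R >= 1 and R >= B' / e follows e * R^2 >= B', so G is positive on |x| =
    R.\<close>
  define R where "R = max (norm x1) (max 1 (B' / e))"
  have R: "R \<ge> norm x1" "R \<ge> 1" "R \<ge> B' / e" by (auto simp: R_def)
  have R2: "e * R\<^sup>2 \<ge> B'"
  proof -
    have "R \<le> R\<^sup>2" using R(2) by (simp add: power2_eq_square)
    then have "e * R \<le> e * R\<^sup>2" using e by (intro mult_left_mono) auto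
    moreover have "B' \<le> e * R" using R(3) e by (simp add: pos_divide_le_eq mult.commute)
    ultimately show ?thesis by linarith
  qed
  obtain t0' where t0': "t0' > 0" and
    ini: "\<And>x t. d \<le> norm x \<Longrightarrow> norm x \<le> R \<Longrightarrow> 0 < t \<Longrightarrow> t \<le> t0' \<Longrightarrow> - (e/2) \<le> h x t"
    using initial[of "e/2" R] e by (metis half_gt_zero)
  define t0 where "t0 = min t0' t1"
  have t0: "t0 > 0" "t0 \<le> t0'" "t0 \<le> t1" using t0' t1 by (auto simp: t0_def)
  define K where "K = {x :: real ^ 'n. d \<le> norm x \<and> norm x \<le> R} \<times> {t0..t1}"
  have "{x :: real ^ 'n. d \<le> norm x \<and> norm x \<le> R} = cball 0 R \<inter> {x. d \<le> norm x}" by auto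
  moreover have "closed {x :: real ^ 'n. d \<le> norm x}"
    by (intro closed_Collect_le continuous_intros)
  ultimately have "compact {x :: real ^ 'n. d \<le> norm x \<and> norm x \<le> R}"
    by (simp add: compact_Int_closed)
  then have K: "compact K" unfolding K_def by (intro compact_Times) auto
  have "continuous_on K (\<lambda>z. h (fst z) (snd z))"
    by (rule continuous_on_subset[OF cont[unfolded case_prod_unfold]])
       (use t0 t1 in \<open>auto simp: K_def\<close>)
  then have contG: "continuous_on K (\<lambda>z. G (fst z) (snd z))"
    unfolding G_def w_def by (intro continuous_intros)
  have "(x1, t1) \<in> K" using x1 R t0 by (auto simp: K_def)
  then obtain z where z: "z \<in> K" and zmin: "\<And>y. y \<in> K \<Longrightarrow> G (fst z) (snd z) \<le> G (fst y) (snd y)"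
    using continuous_attains_inf[OF K _ contG] by blast
  obtain x t where zt: "z = (x, t)" by (cases z)
  have Gmin: "G x t \<le> G y s" if "d \<le> norm y" "norm y \<le> R" "t0 \<le> s" "s \<le> t1" for y s
    using zmin[of "(y, s)"] that by (simp add: zt K_def)
  have xt: "d \<le> norm x" "norm x \<le> R" "t0 \<le> t" "t \<le> t1" using z by (auto simp: zt K_def)
  have tpos: "t > 0" "t \<le> T" using xt t0 t1 by auto
  have Gneg: "G x t < 0" using Gmin[of x1 t1] x1 R t0 G1 by auto
  have ew: "e * w x t \<ge> e * (norm x)\<^sup>2 + e"
    using mult_left_mono[OF w1[OF tpos(1), of x], of e] e by (simp add: distrib_left)
  have enn: "e * (norm x)\<^sup>2 \<ge> 0" using e by simp
  have ew': "e * w x t > 0" using ew e enn by linarith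
  have hneg: "h x t < 0"
  proof (rule ccontr)
    assume "\<not> h x t < 0"
    then have "exp (- C * t) * h x t \<ge> 0" by simp
    then show False using Gneg ew' unfolding G_def by linarith
  qed
  have expC: "exp (- C * t) \<le> 1" using C tpos by simp
  have hle: "exp (- C * t) * h x t \<ge> h x t"
    using mult_right_mono_neg[OF expC, of "h x t"] hneg by simp
  \<comment> \<open>At the bottom time h >= - e / 2, while \<open>e * w\<close> is at least
    e.\<close>
  have "t \<noteq> t0"
  proof
    assume "t = t0"
    then have "h x t \<ge> - (e/2)" using ini[of x t] xt t0 tpos by simp
    then have "G x t \<ge> - (e/2) + e + e * (norm x)\<^sup>2" unfolding G_def using hle ew by linarith
    then show False using Gneg e enn by linarith
  qed
  then have tt0: "t > t0" using xt by simp
  have xd: "norm x > d" using lateral[of x t] hneg tpos xt by (cases "norm x = d") auto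
  have xR: "norm x < R"
  proof (rule ccontr)
    assume "\<not> norm x < R"
    then have "norm x = R" using xt by simp
    then have "e * w x t \<ge> B' + e" using ew R2 by simp
    moreover have "h x t \<ge> - B'" using bdd[OF xt(1) tpos] by (simp add: B'_def)
    ultimately show False using Gneg hle e unfolding G_def by linarith
  qed
  obtain ht l where ht: "(h x has_real_derivative ht) (at t)" and l: "has_laplacian (\<lambda>y. h y t) l x"
    and hl: "ht - l \<ge> C * h x t"
    using super[OF xd tpos hneg] by blast
  define Gt where "Gt = exp (- C * t) * ht - C * exp (- C * t) * h x t + e * (2 * ?n + 1)"
  have dG: "(G x has_real_derivative Gt) (at t)"
    unfolding G_def w_def Gt_def
    by (rule derivative_eq_intros ht refl | simp)+
  have "has_laplacian (\<lambda>y. exp (- C * t) * h y t + e * ((norm y)\<^sup>2 + ((2 * ?n + 1) * t + 1)))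
      (exp (- C * t) * l + e * (2 * ?n + 0)) x"
    by (intro has_laplacian_add has_laplacian_cmult l has_laplacian_norm_power2 has_laplacian_const)
  then have lG: "has_laplacian (\<lambda>y. G y t) (exp (- C * t) * l + e * (2 * ?n)) x"
    by (simp add: G_def w_def add.assoc)
  have "open {y :: real ^ 'n. d < norm y \<and> norm y < R}"
    by (intro open_Collect_conj open_Collect_less continuous_intros)
  then have "\<forall>\<^sub>F y in nhds x. y \<in> {y. d < norm y \<and> norm y < R}"
    using xd xR by (intro eventually_nhds_in_open) auto
  then have "\<forall>\<^sub>F y in nhds x. G x t \<le> G y t"
    by eventually_elim (use Gmin xt in auto)
  then have lpos: "exp (- C * t) * l + e * (2 * ?n) \<ge> 0"
    by (rule laplacian_nonneg_at_local_min[OF lG])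
  \<comment> \<open>The minimum may lie at the final time \<open>t1\<close>, so only earlier times
    can be compared and a sign of the time derivative is all one gets.\<close>
  have "Gt \<le> 0"
  proof (rule ccontr)
    assume "\<not> Gt \<le> 0"
    then obtain k where k: "k > 0" "\<And>h. h > 0 \<Longrightarrow> h < k \<Longrightarrow> G x (t - h) < G x t"
      using DERIV_pos_inc_left[OF dG] by auto
    define s where "s = min (k/2) (t - t0)"
    have "s > 0" "s < k" "t - s \<ge> t0" using k tt0 by (auto simp: s_def)
    then show False using k(2)[of s] Gmin[of x "t - s"] xt by auto
  qed
  moreover have "exp (- C * t) * (C * h x t) \<le> exp (- C * t) * (ht - l)"
    using hl by (intro mult_left_mono) auto
  moreover have "Gt = exp (- C * t) * (ht - l) - exp (- C * t) * (C * h x t)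
      + (exp (- C * t) * l + e * (2 * ?n)) + e"
    unfolding Gt_def by (simp add: distrib_left right_diff_distrib)
  ultimately show False
    using lpos e by linarith
qed

section \<open>The exponents\<close>

text \<open>With r = sqrt (n - 1), the bound p >= p_JL amounts to m <= (n - 4) / 2 - r, and the
  discriminant \<open>k\<close> under the root in \<open>sigma_exp\<close> equals ((n - 4) / 2 -
  m)^2 - r^2; hence it is nonnegative. The last identity says that |x|^-s is a steady state of the
  linearization.\<close>

lemma exponent_facts:
  fixes p :: real and N :: nat
  assumes N: "N \<ge> 11" and p: "p \<ge> p_JL N"
  defines "m \<equiv> 2 / (p - 1)" and "n \<equiv> real N" and "s \<equiv> sigma_exp N p"
  shows "p > 1" "0 < m" "m < n - 2" "m < s" "2 * s < n"
    "s * (n - 2 - s) = p * m * (n - 2 - m)"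
proof -
  define r where "r = sqrt (n - 1)"
  have n: "n \<ge> 11" using N by (simp add: n_def)
  \<comment> \<open>Dimension at least 11 enters through 2 * r < n - 4, which makes the denominator
    of \<open>p_JL\<close> positive.\<close>
  have r2: "r\<^sup>2 = n - 1" and r0: "r \<ge> 0" using n by (auto simp: r_def)
  have "2 * r < n - 4"
  proof (rule power2_less_imp_less)
    have "4 * (n - 1) < (n - 4)\<^sup>2"
    proof -
      have "(n - 4)\<^sup>2 - 4 * (n - 1) = (n - 11) * (n - 1) + 9" by (simp add: power2_eq_square algebra_simps)
      moreover have "(n - 11) * (n - 1) \<ge> 0" using n by simp
      ultimately show ?thesis by linarith
    qed
    then show "(2 * r)\<^sup>2 < (n - 4)\<^sup>2" by (simp add: power_mult_distrib r2)
  qed (use n in simp)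
  then have D: "n - 4 - 2 * r > 0" by simp
  have "p_JL N = (n - 2 * r) / (n - 4 - 2 * r)" by (simp add: p_JL_def r_def n_def)
  also have "\<dots> = 1 + 4 / (n - 4 - 2 * r)" using D by (simp add: field_simps)
  finally have pJ: "p - 1 \<ge> 4 / (n - 4 - 2 * r)" using p by simp
  have J: "4 / (n - 4 - 2 * r) > 0" using D by simp
  show p1: "p > 1" using pJ J by linarith
  then show m0: "0 < m" by (simp add: m_def)
  have "m \<le> 2 / (4 / (n - 4 - 2 * r))" unfolding m_def using pJ J p1 by (intro divide_left_mono mult_pos_pos) auto
  then have mJ: "m \<le> (n - 4) / 2 - r" by (simp add: field_simps)
  then have mr: "2 * m + 2 * r \<le> n - 4" by (simp add: field_simps)
  then show mn: "m < n - 2" using n r0 by linarith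
  have pm: "p * m = m + 2" using p1 by (simp add: m_def field_simps)
  define k where "k = (n - 2)\<^sup>2 / 4 - p * m * (n - 2 - m)"
  have k: "k = ((n - 4) / 2 - m)\<^sup>2 - r\<^sup>2"
    unfolding k_def pm r2 by (simp add: power2_eq_square field_simps)
  have "r\<^sup>2 \<le> ((n - 4) / 2 - m)\<^sup>2" using mJ r0 by (intro power_mono) auto
  then have k0: "k \<ge> 0" using k by simp
  have s: "s = (n - 2) / 2 - sqrt k"
    by (simp add: s_def sigma_exp_def k_def n_def m_def)
  have sq: "sqrt k * sqrt k = k" using k0 by simp
  show "s * (n - 2 - s) = p * m * (n - 2 - m)"
  proof -
    have "s * (n - 2 - s) = (n - 2)\<^sup>2 / 4 - sqrt k * sqrt k"
      unfolding s by (simp add: power2_eq_square field_simps)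
    then show ?thesis unfolding sq by (simp add: k_def)
  qed
  have "2 * s = n - 2 - 2 * sqrt k" by (simp add: s field_simps)
  then show "2 * s < n" using real_sqrt_ge_zero[OF k0] by linarith
  \<comment> \<open>Strictness comes from p > 1: replacing p * m by m in \<open>k\<close> would give
    exactly the square on the right.\<close>
  have "k < ((n - 2) / 2 - m)\<^sup>2"
  proof -
    have "k = ((n - 2) / 2 - m)\<^sup>2 - 2 * (n - 2 - m)"
      unfolding k_def pm by (simp add: power2_eq_square field_simps)
    then show ?thesis using mn by simp
  qed
  then have "sqrt k < (n - 2) / 2 - m" using mr r0 by (intro real_less_lsqrt) auto
  then show "m < s" by (simp add: s)
qed

section \<open>The singular steady state and the linear barrier\<close>

text \<open>A convex function lies above its tangents; the cases a = 0 and b = 0 are separate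
  because the derivative of \<open>powr\<close> is available on positive reals only.\<close>

lemma powr_tangent:
  fixes a b p :: real
  assumes "p > 1" "a \<ge> 0" "b \<ge> 0"
  shows "b powr p + p * b powr (p - 1) * (a - b) \<le> a powr p"
proof -
  consider "b = 0" | "b > 0" "a = 0" | "b > 0" "a > 0" using assms by fastforce
  then show ?thesis
  proof cases
    case 1
    then show ?thesis using assms by simp
  next
    case 2
    have "b powr p = b powr (p - 1) * b" using 2 by (simp add: powr_diff)
    then show ?thesis using 2 assms by (simp add: algebra_simps)
  next
    case 3
    have "p * b powr (p - 1) * (a - b) \<le> a powr p - b powr p"
    proof (rule f''_imp_f'[where C = "{0<..}" and f'' = "\<lambda>x. p * ((p - 1) * x powr (p - 1 - 1))"])
      show "((\<lambda>x. x powr p) has_real_derivative p * x powr (p - 1)) (at x)" if "x \<in> {0<..}" for x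
        using that by (intro has_real_derivative_powr) simp
      show "((\<lambda>x. p * x powr (p - 1)) has_real_derivative p * ((p - 1) * x powr (p - 1 - 1))) (at x)"
        if "x \<in> {0<..}" for x
        using that by (intro DERIV_cmult has_real_derivative_powr) simp
    qed (use assms 3 in auto)
    then show ?thesis by simp
  qed
qed

lemma sing_coeff_pos:
  assumes "p > 1" "2 / (p - 1) < real n - 2"
  shows "sing_coeff n p > 0"
proof -
  have "2 / (p - 1) * (real n - 2 - 2 / (p - 1)) > 0"
    using assms by (intro mult_pos_pos) auto
  then show ?thesis unfolding sing_coeff_def powr_gt_zero by (metis less_irrefl)
qed

lemma sing_coeff_powr:
  assumes "p > 1" "2 / (p - 1) < real n - 2"
  shows "sing_coeff n p powr (p - 1) = 2 / (p - 1) * (real n - 2 - 2 / (p - 1))"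
proof -
  have "2 / (p - 1) * (real n - 2 - 2 / (p - 1)) > 0"
    using assms by (intro mult_pos_pos) auto
  moreover have "(B powr (1 / (p - 1))) powr (p - 1) = B" if "B > 0" for B
    using that assms(1) by (simp add: powr_powr)
  ultimately show ?thesis unfolding sing_coeff_def by blast
qed

lemma norm_powr_eq: "norm x powr a = ((norm x)\<^sup>2) powr (a / 2)"
  by (cases "norm x = 0") (auto simp: powr_powr simp flip: powr_numeral)

text \<open>Multiplied by p this is the inverse square potential of the linearization at
  \<open>v_inf\<close>, to be matched with the constant s * (n - 2 - s) of the barrier.\<close>

lemma v_inf_powr:
  fixes x :: "real ^ 'n"
  assumes "p > 1" "2 / (p - 1) < real CARD('n) - 2" "x \<noteq> 0"
  shows "v_inf p x powr (p - 1) = 2 / (p - 1) * (real CARD('n) - 2 - 2 / (p - 1)) / (norm x)\<^sup>2"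
proof -
  have "v_inf p x powr (p - 1) = sing_coeff CARD('n) p powr (p - 1) * (norm x powr (- 2 / (p - 1))) powr (p - 1)"
    unfolding v_inf_def using sing_coeff_pos[OF assms(1,2)] by (simp add: powr_mult)
  also have "(norm x powr (- 2 / (p - 1))) powr (p - 1) = norm x powr (- 2)"
  proof -
    have "- 2 / (p - 1) * (p - 1) = - 2" using assms(1) by (simp add: field_simps)
    then show ?thesis by (simp only: powr_powr)
  qed
  also have "\<dots> = 1 / (norm x)\<^sup>2" using assms(3) by (simp add: powr_minus_divide)
  finally show ?thesis by (simp add: sing_coeff_powr[OF assms(1,2)])
qed

text \<open>The Laplacian multiplies |x|^-m by - m * (n - 2 - m) / |x|^2, and
  \<open>sing_coeff\<close> is the constant whose power p - 1 is m * (n - 2 - m).\<close>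

lemma has_laplacian_v_inf:
  fixes x :: "real ^ 'n"
  assumes p: "p > 1" "2 / (p - 1) < real CARD('n) - 2" and x: "x \<noteq> 0"
  shows "has_laplacian (v_inf p) (- (v_inf p x powr p)) x"
proof -
  let ?n = "real CARD('n)"
  define L where "L = sing_coeff CARD('n) p"
  define m where "m = 2 / (p - 1)"
  define a where "a = - m / 2"
  define q where "q = (norm x)\<^sup>2"
  have q: "q > 0" using x by (simp add: q_def)
  have L: "L > 0" unfolding L_def by (rule sing_coeff_pos[OF p])
  have "has_laplacian (\<lambda>y. L * ((norm y)\<^sup>2) powr a)
    (4 * (norm x)\<^sup>2 * (L * (a * ((a - 1) * ((norm x)\<^sup>2) powr (a - 1 - 1))))
      + 2 * ?n * (L * (a * ((norm x)\<^sup>2) powr (a - 1)))) x"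
    using x by (intro has_laplacian_radial[where F = "\<lambda>q. L * q powr a"]
        DERIV_cmult has_real_derivative_powr) auto
  moreover have "(\<lambda>y. L * ((norm y)\<^sup>2) powr a) = (v_inf p :: real ^ 'n \<Rightarrow> real)"
    by (simp add: fun_eq_iff v_inf_def L_def norm_powr_eq a_def m_def)
  moreover have "4 * q * (L * (a * ((a - 1) * q powr (a - 1 - 1)))) + 2 * ?n * (L * (a * q powr (a - 1)))
      = - (v_inf p x powr p)"
  proof -
    have v: "v_inf p x = L * q powr a"
      by (simp add: v_inf_def L_def norm_powr_eq a_def m_def q_def)
    have "v_inf p x powr p = v_inf p x powr (p - 1) * v_inf p x"
      using L q by (simp add: v powr_diff)
    also have "\<dots> = m * (?n - 2 - m) / q * (L * q powr a)"
      by (simp only: v_inf_powr[OF p x]) (simp only: v m_def q_def)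
    finally have 1: "v_inf p x powr p = m * (?n - 2 - m) * L * (q powr a / q)" by simp
    have 2: "q powr (a - 1) = q powr a / q" using q by (simp add: powr_diff)
    have 3: "q powr (a - 1 - 1) = q powr a / q / q" using q by (simp add: powr_diff power2_eq_square)
    have 4: "m = - 2 * a" by (simp add: a_def)
    define Q where "Q = q powr a / q"
    have "4 * q * (L * (a * ((a - 1) * (Q / q)))) + 2 * ?n * (L * (a * Q))
        = L * Q * (4 * (a * (a - 1)) + 2 * ?n * a)"
      using q by (simp add: field_simps power2_eq_square)
    also have "\<dots> = - (m * (?n - 2 - m) * L * Q)"
      unfolding 4 by (simp add: algebra_simps)
    finally show ?thesis unfolding 1 2 3 Q_def .
  qed
  ultimately show ?thesis by (simp add: q_def)
qed

text \<open>With \<open>d = n - 2 * s\<close>, the second factor is a constant plus the heat kernel of the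
  (fractional) dimension \<open>d\<close>: the substitution \<open>z = \<bar>x\<bar>\<^sup>-\<^sup>s * g\<close> turns the operator with the
  inverse square potential into the radial Laplacian in dimension \<open>d\<close>.\<close>

definition barrier :: "real \<Rightarrow> real \<Rightarrow> real \<Rightarrow> real ^ 'n \<Rightarrow> real \<Rightarrow> real" where
  "barrier s e A x t = norm x powr (- s) *
     (e + A * (t + 1) powr (- (real CARD('n) - 2 * s) / 2) * exp (- (norm x)\<^sup>2 / (4 * (t + 1))))"

lemma barrier_equation:
  fixes x :: "real ^ 'n"
  assumes x: "x \<noteq> 0" and t: "t > 0"
  shows "\<exists>zt l. (barrier s e A x has_real_derivative zt) (at t) \<and>
      has_laplacian (\<lambda>y. barrier s e A y t) l x \<and>
      zt - l = s * (real CARD('n) - 2 - s) / (norm x)\<^sup>2 * barrier s e A x t"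
proof -
  let ?n = "real CARD('n)"
  define a where "a = - s / 2"
  define c where "c = - (?n - 2 * s) / 2"
  define T where "T = t + 1"
  have T: "T > 0" using t by (simp add: T_def)
  define E where "E q = A * T powr c * exp (- q / (4 * T))" for q
  define q where "q = (norm x)\<^sup>2"
  have q: "q > 0" using x by (simp add: q_def)
  define zt where "zt = q powr a * (E q * (c / T + q / (4 * T\<^sup>2)))"
  define F where "F r = r powr a * (e + E r)" for r
  define F1 where "F1 r = a * r powr (a - 1) * (e + E r) + r powr a * (- E r / (4 * T))" for r
  define F2 where "F2 r = a * ((a - 1) * r powr (a - 1 - 1)) * (e + E r)
     + 2 * (a * r powr (a - 1) * (- E r / (4 * T))) + r powr a * (E r / (4 * T) / (4 * T))" for r
  have dE: "(E has_real_derivative - E r / (4 * T)) (at r)" for r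
    unfolding E_def using T by (auto intro!: derivative_eq_intros)
  have dP: "((\<lambda>r. r powr b) has_real_derivative b * r powr (b - 1)) (at r)" if "r > 0" for b r :: real
    using that by (rule has_real_derivative_powr)
  have dF: "(F has_real_derivative F1 r) (at r)" if "r > 0" for r
    unfolding F_def F1_def
    by (rule DERIV_cong[OF DERIV_mult[OF dP[OF that] DERIV_add[OF DERIV_const dE]]])
       (simp add: algebra_simps)
  have dF1: "(F1 has_real_derivative F2 r) (at r)" if "r > 0" for r
    unfolding F1_def F2_def
    by (rule DERIV_cong[OF DERIV_add[OF
          DERIV_mult[OF DERIV_cmult[OF dP[OF that]] DERIV_add[OF DERIV_const dE]]
          DERIV_mult[OF dP[OF that] DERIV_cdivide[OF DERIV_minus[OF dE]]]]])
       (simp add: algebra_simps)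
  have bF: "barrier s e A y t = F ((norm y)\<^sup>2)" for y :: "real ^ 'n"
    by (simp add: barrier_def F_def E_def a_def c_def T_def norm_powr_eq)
  have lap: "has_laplacian (\<lambda>y. barrier s e A y t) (4 * q * F2 q + 2 * ?n * F1 q) x"
    unfolding bF q_def by (rule has_laplacian_radial[OF x dF dF1])
  have "((\<lambda>r. r powr c) has_real_derivative c * T powr (c - 1)) (at T)" using T by (rule dP)
  then have dT: "((\<lambda>t. (t + 1) powr c) has_real_derivative c * T powr (c - 1)) (at t)"
    unfolding T_def by (subst (asm) DERIV_shift) (simp add: add.commute)
  have "((\<lambda>t. exp (- q / (4 * (t + 1)))) has_real_derivative exp (- q / (4 * T)) * (q / (4 * T\<^sup>2))) (at t)"
  proof -
    have "((\<lambda>t. t + 1) has_real_derivative 1) (at t)"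
      by (auto intro!: derivative_eq_intros)
    then have "((\<lambda>t. - q / 4 / (t + 1)) has_real_derivative (0 * T - - q / 4 * 1) / (T * T)) (at t)"
      unfolding T_def using t by (intro DERIV_divide DERIV_const) auto
    moreover have "(0 * T - - q / 4 * 1) / (T * T) = q / (4 * T\<^sup>2)"
      by (simp add: power2_eq_square)
    ultimately have "((\<lambda>t. - q / (4 * (t + 1))) has_real_derivative q / (4 * T\<^sup>2)) (at t)"
      by (simp only: divide_divide_eq_left)
    from DERIV_chain2[OF DERIV_exp this] show ?thesis by (simp only: T_def)
  qed
  from DERIV_mult[OF dT this]
  have "((\<lambda>t. q powr a * (e + A * ((t + 1) powr c * exp (- q / (4 * (t + 1))))))
     has_real_derivative q powr a * (0 + A * (c * T powr (c - 1) * exp (- q / (4 * (t + 1))) +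
        exp (- q / (4 * T)) * (q / (4 * T\<^sup>2)) * (t + 1) powr c))) (at t)"
    by (intro DERIV_cmult DERIV_add DERIV_const)
  moreover have "q powr a * (0 + A * (c * T powr (c - 1) * exp (- q / (4 * (t + 1))) +
        exp (- q / (4 * T)) * (q / (4 * T\<^sup>2)) * (t + 1) powr c)) = zt"
  proof -
    have "T powr (c - 1) = T powr c / T" using T by (simp add: powr_diff)
    then show ?thesis unfolding zt_def E_def T_def[symmetric] by (simp add: algebra_simps)
  qed
  moreover have "barrier s e A x = (\<lambda>t. q powr a * (e + A * ((t + 1) powr c * exp (- q / (4 * (t + 1))))))"
    by (simp add: fun_eq_iff barrier_def norm_powr_eq q_def a_def c_def mult.assoc)
  ultimately have dz: "(barrier s e A x has_real_derivative zt) (at t)" by simp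
  have "zt - (4 * q * F2 q + 2 * ?n * F1 q) = s * (?n - 2 - s) / q * F q"
  proof -
    \<comment> \<open>Expressed in Q, H and k the claim is rational. The terms with H * k cancel
      because 4 * c + 8 * a + 2 * n = 0, those with k^2 cancel outright, and the rest is the
      potential term.\<close>
    define Q where "Q = q powr a / q"
    define H where "H = E q"
    define k where "k = 1 / (4 * T)"
    have Q0: "q powr a = q * Q" using q by (simp add: Q_def)
    have Q1: "q powr (a - 1) = Q" using q by (simp add: powr_diff Q_def)
    have Q2: "q powr (a - 1 - 1) = Q / q" using q by (simp add: powr_diff Q_def power2_eq_square)
    have z: "zt = q * Q * (H * (4 * c * k + q * (4 * k\<^sup>2)))"
      using T unfolding zt_def Q0 H_def k_def by (simp add: power2_eq_square)
    have f1: "F1 q = a * Q * (e + H) - q * Q * (H * k)"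
      unfolding F1_def Q0 Q1 H_def k_def by simp
    have f2: "4 * q * F2 q = 4 * (a * (a - 1)) * Q * (e + H) - 8 * q * a * Q * (H * k) + 4 * q * q * Q * (H * k\<^sup>2)"
    proof -
      have "F2 q = a * ((a - 1) * (Q / q)) * (e + H) + 2 * (a * Q * (- H * k)) + q * Q * (H * k * k)"
        unfolding F2_def Q0 Q1 Q2 H_def k_def by simp
      then show ?thesis using q by (simp add: field_simps power2_eq_square)
    qed
    have s: "s = - 2 * a" and c: "c = - ?n / 2 - 2 * a" by (auto simp: a_def c_def field_simps)
    have "zt - (4 * q * F2 q + 2 * ?n * F1 q) = - (4 * (a * (a - 1)) + 2 * ?n * a) * (Q * (e + H))"
      unfolding z f1 f2 c by (simp add: field_simps power2_eq_square)
    also have "\<dots> = s * (?n - 2 - s) * (Q * (e + H))"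
      unfolding s by (simp add: algebra_simps)
    also have "Q * (e + H) = F q / q" by (simp add: F_def Q_def H_def)
    finally show ?thesis by simp
  qed
  then have "zt - (4 * q * F2 q + 2 * ?n * F1 q) = s * (?n - 2 - s) / (norm x)\<^sup>2 * barrier s e A x t"
    by (simp add: bF flip: q_def)
  with dz lap show ?thesis by blast
qed

section \<open>Comparison\<close>

text \<open>The reaction integral is nonnegative, also if a Bochner integral takes its default value
  0. A continuous f below the data then transfers the uniform small-time convergence to
  \<open>w\<close>.\<close>

lemma mild_solution_lower:
  fixes w0 :: "real ^ 'n \<Rightarrow> real" and w :: "real ^ 'n \<Rightarrow> real \<Rightarrow> real"
  assumes sol: "global_solution p w0 w"
    and w0: "w0 \<in> borel_measurable lebesgue" "AE y in lebesgue. \<bar>w0 y\<bar> \<le> N"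
    and f: "f \<in> borel_measurable lebesgue" "AE y in lebesgue. \<bar>f y\<bar> \<le> N'" "AE y in lebesgue. f y \<le> w0 y"
    and t: "t > 0"
  shows "(\<integral>y. heat_kernel t (x - y) * f y \<partial>lebesgue) \<le> w x t"
proof -
  have "(\<integral>y. heat_kernel t (x - y) * f y \<partial>lebesgue) \<le> (\<integral>y. heat_kernel t (x - y) * w0 y \<partial>lebesgue)"
  proof (rule integral_mono_AE)
    show "AE y in lebesgue. heat_kernel t (x - y) * f y \<le> heat_kernel t (x - y) * w0 y"
      using f(3) by eventually_elim (rule mult_left_mono[OF _ less_imp_le[OF heat_kernel_pos[OF t]]])
  qed (rule integrable_heat_kernel_mult[OF t f(1,2)] integrable_heat_kernel_mult[OF t w0])+
  moreover have "0 \<le> (LINT s:{0<..<t}|lebesgue. (\<integral>y. heat_kernel (t - s) (x - y) * w y s powr p \<partial>lebesgue))"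
    unfolding set_lebesgue_integral_def
    by (intro integral_nonneg_AE AE_I2)
       (auto simp: indicator_def intro!: integral_nonneg_AE mult_nonneg_nonneg less_imp_le[OF heat_kernel_pos])
  ultimately show ?thesis
    using sol t unfolding global_solution_def mild_solution_def by simp
qed

text \<open>The kernel has mass one, so the reaction term is at most M powr p per unit of
  time.\<close>

lemma mild_solution_upper:
  fixes w0 :: "real ^ 'n \<Rightarrow> real" and w :: "real ^ 'n \<Rightarrow> real \<Rightarrow> real"
  assumes sol: "global_solution p w0 w" and p: "p > 0"
    and w0: "w0 \<in> borel_measurable lebesgue" "AE y in lebesgue. \<bar>w0 y\<bar> \<le> N"
    and f: "f \<in> borel_measurable lebesgue" "AE y in lebesgue. \<bar>f y\<bar> \<le> N'" "AE y in lebesgue. w0 y \<le> f y"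
    and t: "t > 0" and M: "\<And>y s. 0 < s \<Longrightarrow> s \<le> t \<Longrightarrow> w y s \<le> M"
  shows "w x t \<le> (\<integral>y. heat_kernel t (x - y) * f y \<partial>lebesgue) + t * M powr p"
proof -
  have w0': "0 \<le> w y s" if "s > 0" for y s
    using sol that by (simp add: global_solution_def)
  have "(\<integral>y. heat_kernel t (x - y) * w0 y \<partial>lebesgue) \<le> (\<integral>y. heat_kernel t (x - y) * f y \<partial>lebesgue)"
  proof (rule integral_mono_AE)
    show "AE y in lebesgue. heat_kernel t (x - y) * w0 y \<le> heat_kernel t (x - y) * f y"
      using f(3) by eventually_elim (rule mult_left_mono[OF _ less_imp_le[OF heat_kernel_pos[OF t]]])
  qed (rule integrable_heat_kernel_mult[OF t f(1,2)] integrable_heat_kernel_mult[OF t w0])+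
  note heat = this
  have inner: "(\<integral>y. heat_kernel (t - s) (x - y) * w y s powr p \<partial>lebesgue) \<le> M powr p"
    if s: "0 < s" "s < t" for s
  proof -
    have ts: "t - s > 0" using s by simp
    have "(\<integral>y. heat_kernel (t - s) (x - y) * w y s powr p \<partial>lebesgue)
        \<le> (\<integral>y. heat_kernel (t - s) (x - y) * M powr p \<partial>lebesgue)"
    \<comment> \<open>Only the majorant has to be shown integrable: a left side that is not
      integrable has integral 0.\<close>
    proof (rule integral_mono')
      show "integrable lebesgue (\<lambda>y. heat_kernel (t - s) (x - y) * M powr p)"
        using integrable_heat_kernel[OF ts, of x] by simp
      show "heat_kernel (t - s) (x - y) * w y s powr p \<le> heat_kernel (t - s) (x - y) * M powr p" for y
        using s p M[of s y] w0'[of s y] heat_kernel_pos[OF ts, of "x - y"]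
        by (intro mult_left_mono powr_mono2) auto
    qed (intro mult_nonneg_nonneg less_imp_le[OF heat_kernel_pos[OF ts]] powr_ge_zero)
    also have "\<dots> = M powr p" using integral_heat_kernel[OF ts, of x] by simp
    finally show ?thesis .
  qed
  have "(LINT s:{0<..<t}|lebesgue. (\<integral>y. heat_kernel (t - s) (x - y) * w y s powr p \<partial>lebesgue))
      \<le> (LINT s:{0<..<t}|lebesgue. M powr p)"
    unfolding set_lebesgue_integral_def
  proof (rule integral_mono')
    show "integrable lebesgue (\<lambda>s. indicator {0<..<t} s *\<^sub>R M powr p)"
      using t by (intro integrable_scaleR_left integrable_real_indicator) auto
  qed (use inner in \<open>auto simp: indicator_def\<close>)
  also have "\<dots> = t * M powr p"
    using t by (simp add: set_lebesgue_integral_def)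
  finally show ?thesis
    using heat sol t unfolding global_solution_def mild_solution_def by simp
qed

lemma global_solution_equation:
  fixes w0 :: "real ^ 'n \<Rightarrow> real" and w :: "real ^ 'n \<Rightarrow> real \<Rightarrow> real"
  assumes "global_solution p w0 w" "t > 0"
  shows "\<exists>wt l. (w x has_real_derivative wt) (at t) \<and> has_laplacian (\<lambda>y. w y t) l x \<and>
           wt = l + w x t powr p"
proof -
  obtain wt Dw D2w where *:
    "\<forall>x. \<forall>t>0. ((\<lambda>s. w x s) has_real_derivative wt x t) (at t) \<and>
           ((\<lambda>y. w y t) has_derivative (\<lambda>h. Dw x t \<bullet> h)) (at x) \<and>
           ((\<lambda>y. Dw y t) has_derivative (\<lambda>h. D2w x t *v h)) (at x) \<and>
           wt x t = trace (D2w x t) + w x t powr p"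
    using assms(1) unfolding global_solution_def classical_solution_def by blast
  have "has_laplacian (\<lambda>y. w y t) (trace (D2w x t)) x"
    using * assms(2) by (intro has_laplacian_of_has_derivative[where Df = "\<lambda>y. Dw y t"]) blast+
  then show ?thesis using * assms(2) by blast
qed

lemma global_solution_continuous:
  "global_solution p w0 w \<Longrightarrow> continuous_on (UNIV \<times> {0<..}) (\<lambda>(x, t). w x t)"
  unfolding global_solution_def classical_solution_def by blast

lemma AE_lebesgue_nonzero:
  fixes P :: "real ^ 'n \<Rightarrow> bool"
  assumes "\<And>y. y \<noteq> 0 \<Longrightarrow> P y"
  shows "AE y in lebesgue. P y"
proof -
  have "AE y in lebesgue. y \<noteq> (0 :: real ^ 'n)"
    by (rule AE_completion[OF AE_lborel_singleton])
  then show ?thesis by eventually_elim (rule assms)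
qed

lemma continuous_on_v_inf: "continuous_on {x. x \<noteq> 0} (v_inf p)"
  unfolding v_inf_def by (intro continuous_intros) auto

section \<open>Upper comparison with the singular steady state\<close>

text \<open>On the ball where \<open>v_inf\<close> is at least a bound M of the solution nothing is
  to be shown. Outside it the minimum principle applies to \<open>v_inf p x - w x t\<close>.\<close>

lemma global_solution_le_v_inf:
  fixes w0 :: "real ^ 'n \<Rightarrow> real" and w :: "real ^ 'n \<Rightarrow> real \<Rightarrow> real"
  assumes p: "p > 1" "2 / (p - 1) < real CARD('n) - 2"
    and sol: "global_solution p w0 w"
    and w0: "w0 \<in> borel_measurable lebesgue" "\<And>y. y \<noteq> 0 \<Longrightarrow> 0 \<le> w0 y \<and> w0 y \<le> N \<and> w0 y \<le> v_inf p y"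
    and x: "x \<noteq> 0" and t: "t > 0"
  shows "w x t \<le> v_inf p x"
proof -
  define L where "L = sing_coeff CARD('n) p"
  define m where "m = 2 / (p - 1)"
  have L: "L > 0" unfolding L_def by (rule sing_coeff_pos[OF p])
  have m: "m > 0" using p by (simp add: m_def)
  have v: "v_inf p y = L * norm y powr (- m)" for y :: "real ^ 'n"
    by (simp add: v_inf_def L_def m_def)
  obtain M0 where M0: "\<And>y s. 0 < s \<Longrightarrow> s \<le> t \<Longrightarrow> w y s \<le> M0"
    using sol t unfolding global_solution_def by fastforce
  \<comment> \<open>Bounds the solution up to time t and the data at once; the 1 makes it
    positive.\<close>
  define M where "M = max (max M0 N) 1"
  have M: "\<And>y s. 0 < s \<Longrightarrow> s \<le> t \<Longrightarrow> w y s \<le> M" "M > 0" "N \<le> M"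
  proof -
    have "M0 \<le> M" by (simp add: M_def)
    then show "w y s \<le> M" if "0 < s" "s \<le> t" for y s using M0[OF that, of y] by simp
  qed (auto simp: M_def)
  have w_nn: "0 \<le> w y s" if "s > 0" for y s
    using sol that by (simp add: global_solution_def)
  have vnn: "v_inf p y \<ge> 0" for y :: "real ^ 'n" using L by (simp add: v)
  \<comment> \<open>The radius at which \<open>v_inf\<close> equals M.\<close>
  define d where "d = (M / L) powr (- 1 / m)"
  have d: "d > 0" using M L by (simp add: d_def)
  have Ld: "L * d powr (- m) = M" using M L m by (simp add: d_def powr_powr)
  have vd: "v_inf p y = M" if "norm y = d" for y :: "real ^ 'n" using Ld that by (simp add: v)
  have vd': "v_inf p y \<ge> M" if "norm y \<le> d" "y \<noteq> 0" for y :: "real ^ 'n"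
  proof -
    have "d powr (- m) \<le> norm y powr (- m)" using that m by (intro powr_mono2') auto
    then show ?thesis unfolding v Ld[symmetric] using L by simp
  qed
  show ?thesis
  proof (cases "norm x \<le> d")
    case True
    then show ?thesis using vd'[OF True x] M(1)[of t x] t by simp
  next
    case False
    \<comment> \<open>This is min (v_inf, M), extended continuously to the origin.\<close>
    define f where "f y = L * (max d (norm y)) powr (- m)" for y :: "real ^ 'n"
    have f_cont: "continuous_on UNIV f"
      unfolding f_def using d by (intro continuous_intros) (auto simp: max_def)
    have f_eq: "f y = v_inf p y" if "norm y \<ge> d" for y
      using that by (simp add: f_def v max_absorb2)
    have f_bd: "\<bar>f y\<bar> \<le> M" for y
    proof -
      have "max d (norm y) powr (- m) \<le> d powr (- m)" using d m by (intro powr_mono2') auto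
      then show ?thesis using L unfolding f_def Ld[symmetric] by (simp add: abs_mult)
    qed
    have w0f: "w0 y \<le> f y" if "y \<noteq> 0" for y
    proof (cases "norm y \<ge> d")
      case True
      then show ?thesis using f_eq w0(2)[OF that] by simp
    next
      case False
      then have "f y = M" using Ld by (simp add: f_def max_absorb1)
      then show ?thesis using w0(2)[OF that] M by simp
    qed
    have "0 \<le> v_inf p x - w x t"
    proof (rule minimum_principle_exterior[where d = d and T = t and B = M and C = "p * M powr (p - 1)"
          and h = "\<lambda>x t. v_inf p x - w x t"])
      show "0 \<le> p * M powr (p - 1)" using p by simp
      show "continuous_on ({x. d \<le> norm x} \<times> {0<..t}) (\<lambda>(x, t). v_inf p x - w x t)"
      proof -
        have "continuous_on ({x. d \<le> norm x} \<times> {0<..t}) (\<lambda>z. v_inf p (fst z))"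
          by (rule continuous_on_compose2[OF continuous_on_v_inf])
             (use d in \<open>auto intro: continuous_intros\<close>)
        moreover have "continuous_on ({x. d \<le> norm x} \<times> {0<..t}) (\<lambda>z. w (fst z) (snd z))"
          by (rule continuous_on_subset[OF global_solution_continuous[OF sol, unfolded case_prod_unfold]]) auto
        ultimately show ?thesis unfolding case_prod_unfold by (rule continuous_on_diff)
      qed
    next
      fix y :: "real ^ 'n" and s assume "d \<le> norm y" "0 < s" "s \<le> t"
      then show "- M \<le> v_inf p y - w y s" using M(1)[of s y] vnn[of y] by simp
    next
      fix y :: "real ^ 'n" and s assume "norm y = d" "0 < s" "s \<le> t"
      then show "0 \<le> v_inf p y - w y s" using M(1)[of s y] vd by simp
    next
      fix R e :: real assume e: "e > 0"
      obtain t1 where t1: "t1 > 0" and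
        ap: "\<And>x t. norm x \<le> R \<Longrightarrow> 0 < t \<Longrightarrow> t \<le> t1 \<Longrightarrow>
          \<bar>(\<integral>y. heat_kernel t (x - y) * f y \<partial>lebesgue) - f x\<bar> \<le> e / 2"
        using heat_kernel_approximate_identity[OF f_cont f_bd, of "e/2" R] e by auto
      define t0 where "t0 = min (min t1 t) (e / (2 * M powr p))"
      have Mp: "M powr p > 0" using M by simp
      have t0: "t0 > 0" "t0 \<le> t1" "t0 \<le> t" "t0 \<le> e / (2 * M powr p)"
        using t1 t e Mp by (auto simp: t0_def)
      have "- e \<le> v_inf p y - w y s" if "d \<le> norm y" "norm y \<le> R" "0 < s" "s \<le> t0" for y s
      proof -
        have "w y s \<le> (\<integral>z. heat_kernel s (y - z) * f z \<partial>lebesgue) + s * M powr p"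
        proof (rule mild_solution_upper[OF sol _ w0(1) _ borel_measurable_continuous_lebesgue[OF f_cont]])
          show "AE y in lebesgue. \<bar>w0 y\<bar> \<le> N" using w0(2) by (intro AE_lebesgue_nonzero) auto
          show "AE y in lebesgue. w0 y \<le> f y" using w0f by (intro AE_lebesgue_nonzero) auto
          show "AE y in lebesgue. \<bar>f y\<bar> \<le> M" using f_bd by simp
        qed (use p M(1) that t0 in auto)
        also have "s * M powr p \<le> e / 2"
        proof -
          have "s \<le> e / (2 * M powr p)" using that t0 by linarith
          then show ?thesis using Mp by (simp add: field_simps)
        qed
        finally have "w y s \<le> (\<integral>z. heat_kernel s (y - z) * f z \<partial>lebesgue) + e / 2" by simp
        moreover have "\<bar>(\<integral>z. heat_kernel s (y - z) * f z \<partial>lebesgue) - f y\<bar> \<le> e / 2"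
          using that t0 by (intro ap) auto
        ultimately show ?thesis unfolding f_eq[OF that(1)] by linarith
      qed
      with t0 show "\<exists>t0>0. \<forall>x t. d \<le> norm x \<longrightarrow> norm x \<le> R \<longrightarrow> 0 < t \<longrightarrow> t \<le> t0 \<longrightarrow> - e \<le> v_inf p x - w x t"
        by blast
    next
      fix y :: "real ^ 'n" and s assume y: "d < norm y" and s: "0 < s" "s \<le> t" and neg: "v_inf p y - w y s < 0"
      have y0: "y \<noteq> 0" using y d by auto
      obtain wt l where wt: "(w y has_real_derivative wt) (at s)" "has_laplacian (\<lambda>y. w y s) l y"
        "wt = l + w y s powr p"
        using global_solution_equation[OF sol s(1)] by blast
      \<comment> \<open>The tangent is taken at w, whose slope is at most p * M powr (p - 1); as the
        difference is negative, the larger slope gives the smaller product.\<close>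
      have "w y s powr p + p * w y s powr (p - 1) * (v_inf p y - w y s) \<le> v_inf p y powr p"
        using p w_nn[OF s(1)] vnn[of y] by (intro powr_tangent) auto
      moreover have "p * M powr (p - 1) * (v_inf p y - w y s) \<le> p * w y s powr (p - 1) * (v_inf p y - w y s)"
        using neg p M(1)[OF s] w_nn[OF s(1)] by (intro mult_right_mono_neg mult_left_mono powr_mono2) auto
      ultimately have "p * M powr (p - 1) * (v_inf p y - w y s) \<le> (0 - wt) - (- (v_inf p y powr p) - l)"
        using wt(3) by linarith
      moreover have "((\<lambda>s. v_inf p y - w y s) has_real_derivative 0 - wt) (at s)"
        by (intro DERIV_diff DERIV_const wt)
      moreover have "has_laplacian (\<lambda>y. v_inf p y - w y s) (- (v_inf p y powr p) - l) y"
        by (intro has_laplacian_diff has_laplacian_v_inf p y0 wt)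
      ultimately show "\<exists>ht l. ((\<lambda>s. v_inf p y - w y s) has_real_derivative ht) (at s) \<and>
         has_laplacian (\<lambda>y. v_inf p y - w y s) l y \<and> p * M powr (p - 1) * (v_inf p y - w y s) \<le> ht - l"
        by blast
    qed (use False t in auto)
    then show ?thesis by simp
  qed
qed

section \<open>Lower comparison with the barrier\<close>

text \<open>The exponential factor increases with time, so the barrier can drop only through the
  power of t + 1; this bound is uniform in |x| >= d and tends to 0 with t. The lower comparison
  needs just this one-sided estimate.\<close>

lemma barrier_time_increment:
  fixes x :: "real ^ 'n"
  assumes "A \<ge> 0" "0 \<le> s" "2 * s < real CARD('n)" "d > 0" "norm x \<ge> d" "t \<ge> 0"
  shows "barrier s e A x 0 - barrier s e A x t
    \<le> d powr (- s) * (A * (1 - (t + 1) powr (- (real CARD('n) - 2 * s) / 2)))"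
proof -
  define c where "c = - (real CARD('n) - 2 * s) / 2"
  define q where "q = (norm x)\<^sup>2"
  have c1: "(t + 1) powr c \<le> 1"
    using powr_mono[of c 0 "t + 1"] assms by (simp add: c_def)
  have "q / (4 * (t + 1)) \<le> q / 4" using assms by (intro divide_left_mono) (auto simp: q_def)
  then have "exp (- q / 4) \<le> exp (- q / (4 * (t + 1)))" by simp
  then have 1: "(t + 1) powr c * exp (- q / 4) \<le> (t + 1) powr c * exp (- q / (4 * (t + 1)))"
    by (intro mult_left_mono) auto
  have 2: "exp (- q / 4) - (t + 1) powr c * exp (- q / (4 * (t + 1))) \<le> exp (- q / 4) * (1 - (t + 1) powr c)"
    using 1 unfolding right_diff_distrib mult.commute[of "exp (- q / 4)"] mult_1 by linarith
  have "barrier s e A x 0 = norm x powr (- s) * (e + A * exp (- q / 4))"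
    by (simp add: barrier_def q_def)
  moreover have "barrier s e A x t
      = norm x powr (- s) * (e + A * ((t + 1) powr c * exp (- q / (4 * (t + 1)))))"
    unfolding barrier_def c_def q_def by (simp only: mult.assoc)
  ultimately have "barrier s e A x 0 - barrier s e A x t
      = norm x powr (- s) * (A * (exp (- q / 4) - (t + 1) powr c * exp (- q / (4 * (t + 1)))))"
    by (simp only: right_diff_distrib distrib_left)
  also have "\<dots> \<le> norm x powr (- s) * (A * (exp (- q / 4) * (1 - (t + 1) powr c)))"
    using 2 assms(1) by (intro mult_left_mono) auto
  also have "\<dots> \<le> d powr (- s) * (A * (1 * (1 - (t + 1) powr c)))"
    using assms c1 by (intro mult_mono mult_nonneg_nonneg powr_mono2') (auto simp: q_def)
  finally show ?thesis by (simp add: c_def)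
qed

lemma continuous_on_barrier:
  "continuous_on ({x. x \<noteq> 0} \<times> {0<..}) (\<lambda>z. barrier s e A (fst z) (snd z))"
  unfolding barrier_def by (intro continuous_intros) auto

text \<open>Since m < s, the quotient of the two sides is a multiple of |x|^(s - m), which vanishes
  at the origin; d is where it reaches 1.\<close>

lemma v_inf_le_power:
  fixes x :: "real ^ 'n"
  assumes p: "p > 1" "2 / (p - 1) < real CARD('n) - 2" and s: "2 / (p - 1) < s" and e: "e > 0"
  shows "\<exists>d>0. \<forall>x :: real ^ 'n. x \<noteq> 0 \<longrightarrow> norm x \<le> d \<longrightarrow> v_inf p x \<le> e * norm x powr (- s)"
proof -
  define L where "L = sing_coeff CARD('n) p"
  define m where "m = 2 / (p - 1)"
  have L: "L > 0" unfolding L_def by (rule sing_coeff_pos[OF p])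
  have sm: "s - m > 0" using s by (simp add: m_def)
  define d where "d = (e / L) powr (1 / (s - m))"
  have d: "d > 0" using e L by (simp add: d_def)
  have "v_inf p x \<le> e * norm x powr (- s)" if x: "x \<noteq> 0" "norm x \<le> d" for x :: "real ^ 'n"
  proof -
    have "norm x powr (s - m) \<le> d powr (s - m)" using x sm by (intro powr_mono2) auto
    also have "\<dots> = e / L" using sm e L by (simp add: d_def powr_powr)
    finally have "L * norm x powr (s - m) \<le> e" using L by (simp add: field_simps)
    then have "(L * norm x powr (s - m)) * norm x powr (- s) \<le> e * norm x powr (- s)"
      by (intro mult_right_mono) auto
    moreover have "norm x powr (s - m) * norm x powr (- s) = norm x powr (- m)"
      using x by (simp flip: powr_add)
    ultimately show ?thesis by (simp add: v_inf_def L_def m_def mult.assoc)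
  qed
  with d show ?thesis by blast
qed

text \<open>Since \<open>2 / (p - 1) < s\<close>, the term \<open>e * \<bar>x\<bar>\<^sup>-\<^sup>s\<close> of the barrier makes \<open>v_inf - barrier\<close> negative
  near the origin. The subsolution \<open>max 0 (v_inf - barrier)\<close> is therefore bounded, and lies below
  the truncated data as soon as \<open>N\<close> exceeds its bound.\<close>

lemma global_solution_ge_v_inf_diff_barrier:
  fixes s e A p :: real
  assumes p: "p > 1" "2 / (p - 1) < real CARD('n) - 2"
    and s: "2 / (p - 1) < s" "2 * s < real CARD('n)"
    and char: "s * (real CARD('n) - 2 - s) = p * (2 / (p - 1)) * (real CARD('n) - 2 - 2 / (p - 1))"
    and e: "e > 0" and A: "A > 0"
  shows "\<exists>K>0. \<forall>N\<ge>K. \<forall>(w0 :: real ^ 'n \<Rightarrow> real) w.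
     global_solution p w0 w \<longrightarrow> w0 \<in> borel_measurable lebesgue \<longrightarrow>
     (\<forall>y. y \<noteq> 0 \<longrightarrow> 0 \<le> w0 y \<and> w0 y \<le> N \<and> min N (v_inf p y - barrier s e A y 0) \<le> w0 y) \<longrightarrow>
     (\<forall>x t. x \<noteq> 0 \<longrightarrow> t > 0 \<longrightarrow> v_inf p x - barrier s e A x t \<le> w x t)"
proof -
  let ?b = "barrier s e A :: real ^ 'n \<Rightarrow> real \<Rightarrow> real"
  define L where "L = sing_coeff CARD('n) p"
  define m where "m = 2 / (p - 1)"
  have L: "L > 0" unfolding L_def by (rule sing_coeff_pos[OF p])
  have m: "m > 0" using p by (simp add: m_def)
  have "m < s" using s by (simp add: m_def)
  then have s0: "s > 0" using m by linarith
  have v: "v_inf p y = L * norm y powr (- m)" for y :: "real ^ 'n"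
    by (simp add: v_inf_def L_def m_def)
  have vnn: "v_inf p y \<ge> 0" for y :: "real ^ 'n" using L by (simp add: v)
  obtain d where d: "d > 0" and
    vd: "\<And>y :: real ^ 'n. y \<noteq> 0 \<Longrightarrow> norm y \<le> d \<Longrightarrow> v_inf p y \<le> e * norm y powr (- s)"
    using v_inf_le_power[OF p s(1) e] by blast
  have b_ge: "e * norm y powr (- s) \<le> ?b y t" if "t \<ge> 0" for y t
  proof -
    have "norm y powr (- s) * (e + 0) \<le> ?b y t"
      unfolding barrier_def using A by (intro mult_left_mono add_left_mono mult_nonneg_nonneg) auto
    then show ?thesis by (simp add: mult.commute)
  qed
  have b_nn: "0 \<le> ?b y t" if "t \<ge> 0" for y t
    using b_ge[OF that, of y] e by (meson mult_nonneg_nonneg less_imp_le order_trans powr_ge_zero)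
  have near: "v_inf p y - ?b y t \<le> 0" if "y \<noteq> 0" "norm y \<le> d" "t \<ge> 0" for y t
    using vd[OF that(1,2)] b_ge[OF that(3), of y] by linarith
  \<comment> \<open>The value of \<open>v_inf\<close> on |x| = d. It depends on e through d, but not
    on N, the solution or the time.\<close>
  define K where "K = L * d powr (- m)"
  have K: "K > 0" using L d by (simp add: K_def)
  have vK: "v_inf p y \<le> K" if "norm y \<ge> d" for y :: "real ^ 'n"
    unfolding v K_def using that d L m by (intro mult_left_mono powr_mono2') auto
  have SK: "v_inf p y - ?b y t \<le> K" if "norm y \<ge> d" "t \<ge> 0" for y t
    using vK[OF that(1)] b_nn[OF that(2), of y] by linarith
  define S0 where "S0 r = L * r powr (- m) - r powr (- s) * (e + A * exp (- r\<^sup>2 / 4))" for r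
  have S0: "v_inf p y - ?b y 0 = S0 (norm y)" for y
    by (simp add: v barrier_def S0_def)
  \<comment> \<open>The initial profile is frozen inside the ball at its value on the sphere |y| =
    d, which is at most 0 by \<open>S0d\<close>; so f vanishes there and is continuous
    everywhere.\<close>
  define f where "f y = max 0 (S0 (max d (norm y)))" for y :: "real ^ 'n"
  have f_cont: "continuous_on UNIV f"
    unfolding f_def S0_def using d by (intro continuous_intros) (auto simp: max_def)
  have f_ge: "v_inf p y - ?b y 0 \<le> f y" if "norm y \<ge> d" for y
    using that by (simp add: f_def S0 max_absorb2)
  have f_bd: "0 \<le> f y" "f y \<le> K" for y
  proof -
    have "L * max d (norm y) powr (- m) \<le> K"
      unfolding K_def using d L m by (intro mult_left_mono powr_mono2') auto
    moreover have "0 \<le> max d (norm y) powr (- s) * (e + A * exp (- (max d (norm y))\<^sup>2 / 4))"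
      using e A by (intro mult_nonneg_nonneg add_nonneg_nonneg) auto
    ultimately have "S0 (max d (norm y)) \<le> K" unfolding S0_def by linarith
    then show "f y \<le> K" using K by (simp add: f_def)
  qed (simp add: f_def)
  have S0d: "S0 d \<le> 0"
  proof -
    obtain y :: "real ^ 'n" where y: "norm y = d"
      using vector_choose_size[of d] d by auto
    then have "y \<noteq> 0" using d by auto
    then have "v_inf p y - ?b y 0 \<le> 0" using y by (intro near) auto
    then show ?thesis by (simp add: S0 y)
  qed
  have main: "v_inf p x - ?b x t \<le> w x t"
    if N: "N \<ge> K" and sol: "global_solution p w0 w" and w0m: "w0 \<in> borel_measurable lebesgue"
      and w0: "\<And>y. y \<noteq> 0 \<Longrightarrow> 0 \<le> w0 y \<and> w0 y \<le> N \<and> min N (v_inf p y - ?b y 0) \<le> w0 y"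
      and x: "x \<noteq> 0" and t: "t > 0" for N w0 w x t
  proof -
    have w_nn: "0 \<le> w y r" if "r > 0" for y r
      using sol that by (simp add: global_solution_def)
    show ?thesis
    proof (cases "norm x \<le> d")
      case True
      then show ?thesis using near[OF x True, of t] w_nn[OF t, of x] t by simp
    next
      case False
      have w0f: "f y \<le> w0 y" if "y \<noteq> 0" for y
      proof (cases "norm y \<ge> d")
        case True
        \<comment> \<open>As N >= K, the truncation at N does not cut the profile.\<close>
        have "S0 (norm y) \<le> N" using SK[OF True, of 0] N by (simp add: S0)
        then show ?thesis using w0[OF that] True by (simp add: f_def S0 max_absorb2)
      next
        case False
        then have "f y = 0" using S0d by (simp add: f_def max_absorb1)
        then show ?thesis using w0[OF that] by simp
      qed
      have "0 \<le> w x t - (v_inf p x - ?b x t)"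
      proof (rule minimum_principle_exterior[where d = d and T = t and B = K and C = "p * K powr (p - 1)"
            and h = "\<lambda>x t. w x t - (v_inf p x - ?b x t)"])
        show "0 \<le> p * K powr (p - 1)" using p by simp
        show "continuous_on ({x. d \<le> norm x} \<times> {0<..t}) (\<lambda>(x, t). w x t - (v_inf p x - ?b x t))"
        proof -
          have "continuous_on ({x :: real ^ 'n. d \<le> norm x} \<times> {0<..t}) (\<lambda>z. v_inf p (fst z))"
            by (rule continuous_on_compose2[OF continuous_on_v_inf])
               (use d in \<open>auto intro: continuous_intros\<close>)
          moreover have "continuous_on ({x. d \<le> norm x} \<times> {0<..t}) (\<lambda>z. w (fst z) (snd z))"
            by (rule continuous_on_subset[OF global_solution_continuous[OF sol, unfolded case_prod_unfold]]) auto
          moreover have "continuous_on ({x. d \<le> norm x} \<times> {0<..t}) (\<lambda>z. ?b (fst z) (snd z))"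
            by (rule continuous_on_subset[OF continuous_on_barrier]) (use d in auto)
          ultimately show ?thesis unfolding case_prod_unfold by (intro continuous_on_diff)
        qed
      next
        fix y :: "real ^ 'n" and r assume "d \<le> norm y" "0 < r" "r \<le> t"
        then show "- K \<le> w y r - (v_inf p y - ?b y r)" using SK[of y r] w_nn[of r y] by simp
      next
        fix y :: "real ^ 'n" and r assume "norm y = d" "0 < r" "r \<le> t"
        moreover from this have "y \<noteq> 0" using d by auto
        ultimately show "0 \<le> w y r - (v_inf p y - ?b y r)" using near[of y r] w_nn[of r y] by simp
      next
        fix R e' :: real assume e': "e' > 0"
        obtain t1 where t1: "t1 > 0" and
          ap: "\<And>x t. norm x \<le> R \<Longrightarrow> 0 < t \<Longrightarrow> t \<le> t1 \<Longrightarrow>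
            \<bar>(\<integral>y. heat_kernel t (x - y) * f y \<partial>lebesgue) - f x\<bar> \<le> e' / 2"
          using heat_kernel_approximate_identity[OF f_cont, of K "e'/2" R] f_bd e' by auto
        define D where "D r = d powr (- s) * (A * (1 - (r + 1) powr (- (real CARD('n) - 2 * s) / 2)))" for r
        have "(D \<longlongrightarrow> D 0) (at_right 0)"
          unfolding D_def by (intro tendsto_intros) auto
        moreover have "D 0 < e' / 2" using e' by (simp add: D_def)
        ultimately have "\<forall>\<^sub>F r in at_right 0. D r < e' / 2"
          by (rule order_tendstoD(2))
        then obtain t2 where t2: "t2 > 0" and D: "\<And>r. 0 < r \<Longrightarrow> r < t2 \<Longrightarrow> D r < e' / 2"
          unfolding eventually_at_right_field by auto
        have "- e' \<le> w y r - (v_inf p y - ?b y r)"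
          if "d \<le> norm y" "norm y \<le> R" "0 < r" "r \<le> min t1 (t2 / 2)" for y r
        proof -
          have "(\<integral>z. heat_kernel r (y - z) * f z \<partial>lebesgue) \<le> w y r"
          proof (rule mild_solution_lower[OF sol w0m _ borel_measurable_continuous_lebesgue[OF f_cont]])
            show "AE y in lebesgue. \<bar>w0 y\<bar> \<le> N" using w0 by (intro AE_lebesgue_nonzero) auto
            show "AE y in lebesgue. f y \<le> w0 y" using w0f by (intro AE_lebesgue_nonzero) auto
            show "AE y in lebesgue. \<bar>f y\<bar> \<le> K" using f_bd by simp
          qed (use that in auto)
          moreover have "\<bar>(\<integral>z. heat_kernel r (y - z) * f z \<partial>lebesgue) - f y\<bar> \<le> e' / 2"
            using that by (intro ap) auto
          moreover have "?b y 0 - ?b y r \<le> D r"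
            unfolding D_def using that A s0 s(2) d by (intro barrier_time_increment) auto
          moreover have "D r < e' / 2" using that t2 by (intro D) auto
          ultimately show ?thesis using f_ge[OF that(1)] by linarith
        qed
        moreover have "min t1 (t2 / 2) > 0" using t1 t2 by simp
        ultimately show "\<exists>t0>0. \<forall>x t. d \<le> norm x \<longrightarrow> norm x \<le> R \<longrightarrow> 0 < t \<longrightarrow> t \<le> t0 \<longrightarrow>
            - e' \<le> w x t - (v_inf p x - ?b x t)"
          by blast
      next
        fix y :: "real ^ 'n" and r
        assume y: "d < norm y" and r: "0 < r" "r \<le> t" and neg: "w y r - (v_inf p y - ?b y r) < 0"
        have y0: "y \<noteq> 0" using y d by auto
        define S where "S = v_inf p y - ?b y r"
        have S: "w y r < S" "S \<le> K" using neg SK[of y r] y r by (auto simp: S_def)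
        \<comment> \<open>Where the difference is negative, S exceeds w >= 0, so \<open>powr\<close>
          is used at nonnegative arguments only.\<close>
        have S_nn: "0 \<le> S" using S w_nn[OF r(1), of y] by linarith
        obtain wt l where wt: "(w y has_real_derivative wt) (at r)" "has_laplacian (\<lambda>y. w y r) l y"
          "wt = l + w y r powr p"
          using global_solution_equation[OF sol r(1)] by blast
        obtain zt k where zt: "(?b y has_real_derivative zt) (at r)" "has_laplacian (\<lambda>y. ?b y r) k y"
          "zt - k = s * (real CARD('n) - 2 - s) / (norm y)\<^sup>2 * ?b y r"
          using barrier_equation[OF y0 r(1)] by blast
        have "zt - k = p * v_inf p y powr (p - 1) * ?b y r"
          unfolding zt(3) v_inf_powr[OF p y0] char by simp
        \<comment> \<open>Convexity enters twice: the tangent at \<open>v_inf\<close> makes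
          \<open>v_inf - barrier\<close> a subsolution, and the tangent at S below compares it with
          w.\<close>
        moreover have "v_inf p y powr p + p * v_inf p y powr (p - 1) * (S - v_inf p y) \<le> S powr p"
          using p S_nn vnn by (intro powr_tangent) auto
        moreover have "S - v_inf p y = - ?b y r" by (simp add: S_def)
        moreover have "S powr p + p * S powr (p - 1) * (w y r - S) \<le> w y r powr p"
          using p S_nn w_nn[OF r(1)] by (intro powr_tangent) auto
        moreover have "p * K powr (p - 1) * (w y r - S) \<le> p * S powr (p - 1) * (w y r - S)"
          using S S_nn p by (intro mult_right_mono_neg mult_left_mono powr_mono2) auto
        ultimately have "p * K powr (p - 1) * (w y r - S) \<le> (wt - (0 - zt)) - (l - (- (v_inf p y powr p) - k))"
          using wt(3) by simp
        moreover have "((\<lambda>r. w y r - (v_inf p y - ?b y r)) has_real_derivative wt - (0 - zt)) (at r)"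
          by (intro DERIV_diff DERIV_const wt zt)
        moreover have "has_laplacian (\<lambda>y. w y r - (v_inf p y - ?b y r)) (l - (- (v_inf p y powr p) - k)) y"
          by (intro has_laplacian_diff has_laplacian_v_inf p y0 wt zt)
        ultimately show "\<exists>ht l. ((\<lambda>r. w y r - (v_inf p y - ?b y r)) has_real_derivative ht) (at r) \<and>
           has_laplacian (\<lambda>y. w y r - (v_inf p y - ?b y r)) l y \<and>
           p * K powr (p - 1) * (w y r - (v_inf p y - ?b y r)) \<le> ht - l"
          unfolding S_def by blast
      qed (use False t in auto)
      then show ?thesis by simp
    qed
  qed
  show ?thesis
  proof (intro exI[of _ K] conjI K allI impI)
    fix N t :: real and w0 :: "real ^ 'n \<Rightarrow> real" and w and x :: "real ^ 'n"
    assume "K \<le> N" "global_solution p w0 w" "w0 \<in> borel_measurable lebesgue"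
      "\<forall>y. y \<noteq> 0 \<longrightarrow> 0 \<le> w0 y \<and> w0 y \<le> N \<and> min N (v_inf p y - ?b y 0) \<le> w0 y"
      "x \<noteq> 0" "t > 0"
    then show "v_inf p x - ?b x t \<le> w x t" by (intro main[of N w0 w x t]) blast+
  qed
qed

section \<open>Passage to the limit in N and decay for large times\<close>

theorem theorem2p2:
  fixes p :: real
    and u0 :: "real ^ 'n \<Rightarrow> real"
    and u :: "real ^ 'n \<Rightarrow> real \<Rightarrow> real"
  assumes "CARD('n) \<ge> 11"
    and "p \<ge> p_JL CARD('n)"
    and "u0 \<in> borel_measurable lebesgue"
    and "\<forall>x. x \<noteq> 0 \<longrightarrow> 0 \<le> u0 x \<and> u0 x \<le> v_inf p x"
    and "limit_solution p u0 u"
    and "\<exists>b>0. \<forall>x. x \<noteq> 0 \<longrightarrow>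
           v_inf p x - b * norm x powr (- sigma_exp CARD('n) p) \<le> u0 x"
    and "((\<lambda>x. norm x powr sigma_exp CARD('n) p * (v_inf p x - u0 x)) \<longlongrightarrow> 0) at_infinity"
  shows "((\<lambda>t. SUP x\<in>{x. x \<noteq> 0 \<and> norm x \<le> sqrt t}.
             ereal (norm x powr sigma_exp CARD('n) p * (v_inf p x - u x t))) \<longlongrightarrow> 0) at_top
       \<and> ((\<lambda>t. ereal (t powr (sigma_exp CARD('n) p / 2)) *
             (SUP x\<in>{x. x \<noteq> 0 \<and> norm x \<ge> sqrt t}. ereal (v_inf p x - u x t))) \<longlongrightarrow> 0) at_top"
proof -
  define s where "s = sigma_exp CARD('n) p"
  define c where "c = - (real CARD('n) - 2 * s) / 2"
  note P = exponent_facts[OF assms(1,2), folded s_def]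
  have s0: "s > 0" using P(2,4) by linarith
  have c0: "c < 0" using P(5) by (simp add: c_def)
  obtain uN where uN: "\<And>N. N > 0 \<Longrightarrow> global_solution p (\<lambda>x. min (u0 x) N) (uN N)"
    and lim: "\<And>x t. x \<noteq> 0 \<Longrightarrow> t > 0 \<Longrightarrow> ((\<lambda>N. uN N x t) \<longlongrightarrow> u x t) at_top"
    using assms(5) unfolding limit_solution_def by blast
  have meas: "(\<lambda>x. min (u0 x) N) \<in> borel_measurable lebesgue" for N
    using assms(3) by simp
  \<comment> \<open>Supplies the nonnegativity of both suprema.\<close>
  have upper: "u x t \<le> v_inf p x" if x: "x \<noteq> 0" and t: "t > 0" for x t
  proof (rule tendsto_upperbound[OF lim[OF x t]])
    show "\<forall>\<^sub>F N in at_top. uN N x t \<le> v_inf p x"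
      using eventually_gt_at_top[of 0]
    proof eventually_elim
      case (elim N)
      show ?case
        by (rule global_solution_le_v_inf[OF P(1,3) uN[OF elim] meas _ x t, of N])
           (use assms(4) elim in auto)
    qed
  qed simp
  \<comment> \<open>Both limits follow from this bound, which holds for all x other than 0 at once;
    |x| versus sqrt t matters only when the weight is converted.\<close>
  have small: "\<forall>\<^sub>F t in at_top. \<forall>x. x \<noteq> 0 \<longrightarrow> norm x powr s * (v_inf p x - u x t) \<le> e" if e: "e > 0" for e
  proof -
    obtain b where b: "b > 0" and ub: "\<And>x. x \<noteq> 0 \<Longrightarrow> v_inf p x - b * norm x powr (- s) \<le> u0 x"
      using assms(6) by (auto simp: s_def)
    have "\<forall>\<^sub>F x in at_infinity. norm x powr s * (v_inf p x - u0 x) < e / 2"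
      using assms(7) e unfolding s_def by (intro order_tendstoD(2)) auto
    then obtain R where R: "\<And>x. norm x \<ge> R \<Longrightarrow> norm x powr s * (v_inf p x - u0 x) < e / 2"
      unfolding eventually_at_infinity by blast
    \<comment> \<open>For |x| < R this gives A * exp (- |x|^2 / 4) >= b, so the Gaussian term alone
      covers the hypothesis with b; for |x| >= R the term e / 2 suffices.\<close>
    define A where "A = b * exp (R\<^sup>2 / 4)"
    have A: "A > 0" using b by (simp add: A_def)
    have ini: "v_inf p x - barrier s (e/2) A x 0 \<le> u0 x" if x: "x \<noteq> 0" for x
    proof -
      have b0: "barrier s (e/2) A x 0 = norm x powr (- s) * (e / 2 + A * exp (- (norm x)\<^sup>2 / 4))"
        by (simp add: barrier_def)
      have "v_inf p x - u0 x \<le> norm x powr (- s) * (e / 2 + A * exp (- (norm x)\<^sup>2 / 4))"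
      proof (cases "norm x \<ge> R")
        case True
        have "v_inf p x - u0 x = norm x powr (- s) * (norm x powr s * (v_inf p x - u0 x))"
          using x by (simp add: powr_minus)
        also have "\<dots> \<le> norm x powr (- s) * (e / 2 + A * exp (- (norm x)\<^sup>2 / 4))"
        proof (intro mult_left_mono)
          have "A * exp (- (norm x)\<^sup>2 / 4) > 0" using A by simp
          then show "norm x powr s * (v_inf p x - u0 x) \<le> e / 2 + A * exp (- (norm x)\<^sup>2 / 4)"
            using R[OF True] by linarith
        qed auto
        finally show ?thesis .
      next
        case False
        then have "(norm x)\<^sup>2 \<le> R\<^sup>2" by (intro power_mono) auto
        then have "b * 1 \<le> b * exp (R\<^sup>2 / 4 + - (norm x)\<^sup>2 / 4)"
          using b by (intro mult_left_mono) auto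
        then have "b \<le> e / 2 + A * exp (- (norm x)\<^sup>2 / 4)"
          using e unfolding A_def exp_add by (simp add: mult.assoc)
        then have "norm x powr (- s) * b \<le> norm x powr (- s) * (e / 2 + A * exp (- (norm x)\<^sup>2 / 4))"
          by (intro mult_left_mono) auto
        then show ?thesis using ub[OF x] by (simp add: mult.commute)
      qed
      then show ?thesis unfolding b0 by linarith
    qed
    from global_solution_ge_v_inf_diff_barrier[OF P(1,3,4,5,6) half_gt_zero[OF e] A]
    obtain K where K: "K > 0" and cmp: "\<forall>N\<ge>K. \<forall>(w0 :: real ^ 'n \<Rightarrow> real) w.
     global_solution p w0 w \<longrightarrow> w0 \<in> borel_measurable lebesgue \<longrightarrow>
     (\<forall>y. y \<noteq> 0 \<longrightarrow> 0 \<le> w0 y \<and> w0 y \<le> N \<and> min N (v_inf p y - barrier s (e/2) A y 0) \<le> w0 y) \<longrightarrow>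
     (\<forall>x t. x \<noteq> 0 \<longrightarrow> t > 0 \<longrightarrow> v_inf p x - barrier s (e/2) A x t \<le> w x t)"
      by (elim exE conjE) (rule that)
    have lower: "v_inf p x - barrier s (e/2) A x t \<le> u x t" if x: "x \<noteq> 0" and t: "t > 0" for x t
    proof (rule tendsto_lowerbound[OF lim[OF x t]])
      show "\<forall>\<^sub>F N in at_top. v_inf p x - barrier s (e/2) A x t \<le> uN N x t"
        using eventually_ge_at_top[of K]
      proof eventually_elim
        case (elim N)
        have N: "N > 0" using elim K by simp
        show ?case
        proof (rule cmp[rule_format, OF elim uN[OF N] meas _ x t])
          fix y :: "real ^ 'n" assume "y \<noteq> 0"
          then show "0 \<le> min (u0 y) N \<and> min (u0 y) N \<le> N \<and>
              min N (v_inf p y - barrier s (e/2) A y 0) \<le> min (u0 y) N"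
            using assms(4) ini[of y] N by auto
        qed
      qed
    qed simp
    have "((\<lambda>t. (t + 1) powr c) \<longlongrightarrow> 0) at_top"
    proof (rule tendsto_neg_powr[OF c0])
      have "filterlim (\<lambda>t :: real. 1 + t) at_top at_top"
        by (rule filterlim_tendsto_add_at_top[OF tendsto_const filterlim_ident])
      then show "filterlim (\<lambda>t :: real. t + 1) at_top at_top" by (simp add: add.commute)
    qed
    then have "((\<lambda>t. A * (t + 1) powr c) \<longlongrightarrow> A * 0) at_top" by (intro tendsto_intros)
    then have "\<forall>\<^sub>F t in at_top. A * (t + 1) powr c < e / 2"
      using e by (intro order_tendstoD(2)) auto
    then show ?thesis
      using eventually_gt_at_top[of 0]
    proof eventually_elim
      case (elim t)
      show ?case
      proof (intro allI impI)
        fix x :: "real ^ 'n" assume x: "x \<noteq> 0"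
        define E where "E = e / 2 + A * (t + 1) powr c * exp (- (norm x)\<^sup>2 / (4 * (t + 1)))"
        have "norm x powr s * (v_inf p x - u x t) \<le> norm x powr s * barrier s (e/2) A x t"
          using lower[OF x elim(2)] by (intro mult_left_mono) auto
        also have "\<dots> = E"
          using x by (simp add: barrier_def c_def E_def powr_minus)
        also have "\<dots> \<le> e / 2 + A * (t + 1) powr c * 1"
          unfolding E_def using A elim by (intro add_left_mono mult_left_mono) auto
        finally show "norm x powr s * (v_inf p x - u x t) \<le> e" using elim(1) by simp
      qed
    qed
  qed
  \<comment> \<open>A point of both index sets: a supremum over the empty set would be minus
    infinity in \<open>ereal\<close>.\<close>
  have sphere: "\<exists>x :: real ^ 'n. x \<noteq> 0 \<and> norm x = sqrt t" if t: "t > 0" for t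
  proof -
    obtain x :: "real ^ 'n" where "norm x = sqrt t"
      using vector_choose_size[of "sqrt t"] t by auto
    then show ?thesis using t by (intro exI[of _ x]) auto
  qed
  have "((\<lambda>t. SUP x\<in>{x. x \<noteq> 0 \<and> norm x \<le> sqrt t}. ereal (norm x powr s * (v_inf p x - u x t))) \<longlongrightarrow> 0) at_top"
    (is "(?F \<longlongrightarrow> 0) at_top")
  proof (rule order_tendstoI)
    fix a :: ereal assume a: "a < 0"
    show "\<forall>\<^sub>F t in at_top. a < ?F t"
      using eventually_gt_at_top[of 0]
    proof eventually_elim
      case (elim t)
      obtain x :: "real ^ 'n" where x: "x \<noteq> 0" "norm x = sqrt t" using sphere[OF elim] by blast
      have "0 \<le> ereal (norm x powr s * (v_inf p x - u x t))" using upper[OF x(1) elim] by simp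
      also have "\<dots> \<le> ?F t" using x by (intro SUP_upper) auto
      finally show ?case using a by simp
    qed
  next
    fix a :: ereal assume "0 < a"
    then obtain e where e: "0 < ereal e" "ereal e < a" using ereal_dense2 by blast
    then have "e > 0" by simp
    from small[OF this] show "\<forall>\<^sub>F t in at_top. ?F t < a"
    proof eventually_elim
      case (elim t)
      then have "?F t \<le> ereal e" by (intro SUP_least) auto
      then show ?case using e(2) by simp
    qed
  qed
  moreover have "((\<lambda>t. ereal (t powr (s / 2)) * (SUP x\<in>{x. x \<noteq> 0 \<and> norm x \<ge> sqrt t}. ereal (v_inf p x - u x t))) \<longlongrightarrow> 0) at_top"
    (is "((\<lambda>t. ereal (t powr (s / 2)) * ?G t) \<longlongrightarrow> 0) at_top")
  proof (rule order_tendstoI)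
    fix a :: ereal assume a: "a < 0"
    show "\<forall>\<^sub>F t in at_top. a < ereal (t powr (s / 2)) * ?G t"
      using eventually_gt_at_top[of 0]
    proof eventually_elim
      case (elim t)
      obtain x :: "real ^ 'n" where x: "x \<noteq> 0" "norm x = sqrt t" using sphere[OF elim] by blast
      have "0 \<le> ereal (v_inf p x - u x t)" using upper[OF x(1) elim] by simp
      also have "\<dots> \<le> ?G t" using x by (intro SUP_upper) auto
      finally have "0 \<le> ereal (t powr (s / 2)) * ?G t" by (intro ereal_0_le_mult) auto
      then show ?case using a by simp
    qed
  next
    fix a :: ereal assume "0 < a"
    then obtain e where e: "0 < ereal e" "ereal e < a" using ereal_dense2 by blast
    then have e0: "e > 0" by simp
    from small[OF e0] eventually_gt_at_top[of 0]
    show "\<forall>\<^sub>F t in at_top. ereal (t powr (s / 2)) * ?G t < a"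
    proof eventually_elim
      case (elim t)
      \<comment> \<open>On |x| >= sqrt t the weight |x|^-s is at most t^(- s / 2), which cancels the
        prefactor.\<close>
      have "v_inf p x - u x t \<le> e * t powr (- s / 2)" if x: "x \<noteq> 0" "sqrt t \<le> norm x" for x
      proof -
        have "v_inf p x - u x t = norm x powr (- s) * (norm x powr s * (v_inf p x - u x t))"
          using x by (simp add: powr_minus)
        also have "\<dots> \<le> norm x powr (- s) * e"
          using elim(1) x by (intro mult_left_mono) auto
        also have "\<dots> \<le> sqrt t powr (- s) * e"
          using x elim(2) s0 e0 by (intro mult_right_mono powr_mono2') auto
        also have "sqrt t powr (- s) = t powr (- s / 2)"
          using elim(2) by (simp add: powr_half_sqrt[symmetric] powr_powr)
        finally show ?thesis by (simp add: mult.commute)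
      qed
      then have "?G t \<le> ereal (e * t powr (- s / 2))" by (intro SUP_least) auto
      then have "ereal (t powr (s / 2)) * ?G t \<le> ereal (t powr (s / 2)) * ereal (e * t powr (- s / 2))"
        by (intro ereal_mult_left_mono) auto
      also have "\<dots> = ereal e" using elim(2) by (simp add: powr_minus)
      finally show ?case using e(2) by simp
    qed
  qed
  ultimately show ?thesis unfolding s_def by blast
qed

end
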